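(* Let $K$ be a commutative ring, let $\langle\cdot|:T\hookrightarrow V_0\oslash\cdots\oslash V_n$ be a tensor space over $K$ whose frame $(V_0,\dots,V_n)$ consists of finitely generated projective $K$-modules, and let $d=x_0-x_1-\cdots-x_n\in K[X]$. If $P\subseteq K[X]$ is a linear homogeneous ideal of full support, then for every subset $S\subseteq T$, $$\mathbf{N}(P,\mathbf{Z}(S,P))\supseteq\mathbf{N}(d,\mathbf{Z}(S,d)).$$ If $S$ is fully nondegenerate, then this inclusion holds for every linear homogeneous ideal $P\subseteq K[X]$.
   Context: $V_0\oslash\cdots\oslash V_n$ is the $K$-module of $K$-multilinear maps $V_1\times\cdots\times V_n\to V_0$. A tensor space is a $K$-module $T$ with a $K$-linear injection $t\mapsto\langle t|$ into it. $K[X]=K[x_0,\dots,x_n]$. For a commutative $K$-algebra $L$, $\langle t_L|$ is the $L$-multilinear extension of $\langle t|$ to $L\otimes V_1,\dots,L\otimes V_n\to L\otimes V_0$, and $\Omega(L)=\prod_{a=0}^n\operatorname{End}_L(L\otimes V_a)$. For $\omega\in\Omega(L)$ and $p=\sum_e\lambda_eX^e$, $$\langle t_L|p(\omega)|w\rangle=\sum_e\lambda_e\omega_0^{e(0)}\langle t_L|\omega_1^{e(1)}w_1,\dots,\omega_n^{e(n)}w_n\rangle .$$ Write $\langle t_L|p(\omega)=0$ if this vanishes for all $w$. For $S\subseteq T$ and $P\subseteq K[X]$ (a single polynomial stands for the singleton), $\mathbf{Z}(S,P)$ is the functor $L\mapsto\{\omega\in\Omega(L):\langle t_L|p(\omega)=0\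 \forall t\in S,p\in P\}$. For a subfunctor $\Delta\subseteq\Omega$, $\mathbf{N}(P,\Delta)=\{t\in T:\langle t_L|p(\omega)=0\ \forall p\in P,\ \forall L,\ \forall\omega\in\Delta(L)\}$. A linear homogeneous ideal is one generated by polynomials of the form $\sum_a\lambda_ax_a$. Its support is the set of $a\in\{0,\dots,n\}$ such that the coefficients of $x_a$ in the linear homogeneous elements of $P$ generate the unit ideal of $K$; it has full support if this set is $\{0,\dots,n\}$. $S$ is nondegenerate if for each $a\in\{1,\dots,n\}$ and each nonzero $v_a\in V_a$ there are $v_b\in V_b$ ($b\in\{1,\dots,n\}$, $b\ne a$) and $t\in S$ with $\langle t|v_1,\dots,v_n\rangle\ne0$. It is full if $V_0$ is spanned as a $K$-module by all $\langle t|v\rangle$, $t\in S$. Fully nondegenerate means both. *)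

theory Defs
  imports "HOL-Algebra.Algebra" "HOL-Library.Multiset"
begin

text \<open>
  Records for modules inherit the fields \<^const>\<open>monoid.mult\<close> and \<^const>\<open>monoid.one\<close> from rings;
  the locale \<^locale>\<open>module\<close> puts no condition on them, and they are left \<^const>\<open>undefined\<close>
  in the modules constructed below. Maps are extensional, so that they form honest sets.
\<close>

definition linear_maps ::
    "('r, 'c) ring_scheme \<Rightarrow> ('r, 'a, 'd) module_scheme \<Rightarrow> ('r, 'b, 'e) module_scheme \<Rightarrow> ('a \<Rightarrow> 'b) set" where
  "linear_maps R M N = {f \<in> carrier M \<rightarrow>\<^sub>E carrier N.
     (\<forall>x\<in>carrier M. \<forall>y\<in>carrier M. f (x \<oplus>\<^bsub>M\<^esub> y) = f x \<oplus>\<^bsub>N\<^esub> f y) \<and>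
     (\<forall>r\<in>carrier R. \<forall>x\<in>carrier M. f (r \<odot>\<^bsub>M\<^esub> x) = r \<odot>\<^bsub>N\<^esub> f x)}"

definition module_span ::
    "('r, 'c) ring_scheme \<Rightarrow> ('r, 'a, 'd) module_scheme \<Rightarrow> 'a set \<Rightarrow> 'a set" where
  "module_span R M A = \<Inter> {H. submodule H R M \<and> A \<subseteq> H}"

definition finitely_generated ::
    "('r, 'c) ring_scheme \<Rightarrow> ('r, 'a, 'd) module_scheme \<Rightarrow> bool" where
  "finitely_generated R M \<longleftrightarrow>
     (\<exists>A. finite A \<and> A \<subseteq> carrier M \<and> module_span R M A = carrier M)"

definition free_module :: "('r, 'c) ring_scheme \<Rightarrow> 'i set \<Rightarrow> ('r, 'i \<Rightarrow> 'r) module" where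
  "free_module R I = \<lparr>
     carrier = {f. (\<forall>i. f i \<in> carrier R) \<and> {i. f i \<noteq> \<zero>\<^bsub>R\<^esub>} \<subseteq> I \<and> finite {i. f i \<noteq> \<zero>\<^bsub>R\<^esub>}},
     monoid.mult = undefined, one = undefined,
     ring.zero = (\<lambda>i. \<zero>\<^bsub>R\<^esub>), add = (\<lambda>f g i. f i \<oplus>\<^bsub>R\<^esub> g i), smult = (\<lambda>r f i. r \<otimes>\<^bsub>R\<^esub> f i)\<rparr>"

text \<open>
  A module is projective if it is a direct summand of a free module. It suffices to consider bases
  indexed by elements of the type of \<open>M\<close>, because the free module on \<^term>\<open>carrier M\<close> maps
  onto \<open>M\<close>.
\<close>

definition projective_module ::
    "('r, 'c) ring_scheme \<Rightarrow> ('r, 'a, 'd) module_scheme \<Rightarrow> bool" where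
  "projective_module R M \<longleftrightarrow>
     (\<exists>(I :: 'a set) s p. s \<in> linear_maps R M (free_module R I) \<and> p \<in> linear_maps R (free_module R I) M \<and>
        (\<forall>x\<in>carrier M. p (s x) = x))"

text \<open>An \<open>n\<close>-tuple of arguments is an extensional function on \<^term>\<open>{1..n}\<close>.\<close>

definition args :: "nat \<Rightarrow> (nat \<Rightarrow> ('r, 'a, 'd) module_scheme) \<Rightarrow> (nat \<Rightarrow> 'a) set" where
  "args n V = (\<Pi>\<^sub>E a\<in>{1..n}. carrier (V a))"

definition multilinear_maps ::
    "('r, 'c) ring_scheme \<Rightarrow> nat \<Rightarrow> (nat \<Rightarrow> ('r, 'a, 'd) module_scheme) \<Rightarrow> ((nat \<Rightarrow> 'a) \<Rightarrow> 'a) set" where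
  "multilinear_maps R n V = {f \<in> args n V \<rightarrow>\<^sub>E carrier (V 0).
     \<forall>v\<in>args n V. \<forall>a\<in>{1..n}. (\<lambda>x\<in>carrier (V a). f (v(a := x))) \<in> linear_maps R (V a) (V 0)}"

definition multilinear_module ::
    "('r, 'c) ring_scheme \<Rightarrow> nat \<Rightarrow> (nat \<Rightarrow> ('r, 'a, 'd) module_scheme) \<Rightarrow> ('r, (nat \<Rightarrow> 'a) \<Rightarrow> 'a) module" where
  "multilinear_module R n V = \<lparr>
     carrier = multilinear_maps R n V,
     monoid.mult = undefined, one = undefined,
     ring.zero = (\<lambda>v\<in>args n V. \<zero>\<^bsub>V 0\<^esub>),
     add = (\<lambda>f g. \<lambda>v\<in>args n V. f v \<oplus>\<^bsub>V 0\<^esub> g v),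
     smult = (\<lambda>r f. \<lambda>v\<in>args n V. r \<odot>\<^bsub>V 0\<^esub> f v)\<rparr>"

text \<open>The frame is \<open>V 0, \<dots>, V n\<close>, and \<open>br t\<close> is the multilinear map of the tensor \<open>t\<close>.\<close>

locale tensor_space =
  fixes K :: "'k ring" and n :: nat and V :: "nat \<Rightarrow> ('k, 'v) module"
    and T :: "('k, 't) module" and br :: "'t \<Rightarrow> (nat \<Rightarrow> 'v) \<Rightarrow> 'v"
  assumes base_cring: "cring K"
    and frame_module: "a \<le> n \<Longrightarrow> module K (V a)"
    and tensor_module: "module K T"
    and br_linear: "br \<in> linear_maps K T (multilinear_module K n V)"
    and br_inj: "inj_on br (carrier T)"

definition nondegenerate ::
    "nat \<Rightarrow> (nat \<Rightarrow> ('k, 'v) module) \<Rightarrow> ('t \<Rightarrow> (nat \<Rightarrow> 'v) \<Rightarrow> 'v) \<Rightarrow> 't set \<Rightarrow> bool" where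
  "nondegenerate n V br S \<longleftrightarrow>
     (\<forall>a\<in>{1..n}. \<forall>x\<in>carrier (V a) - {\<zero>\<^bsub>V a\<^esub>}.
        \<exists>v\<in>args n V. v a = x \<and> (\<exists>t\<in>S. br t v \<noteq> \<zero>\<^bsub>V 0\<^esub>))"

definition full ::
    "'k ring \<Rightarrow> nat \<Rightarrow> (nat \<Rightarrow> ('k, 'v) module) \<Rightarrow> ('t \<Rightarrow> (nat \<Rightarrow> 'v) \<Rightarrow> 'v) \<Rightarrow> 't set \<Rightarrow> bool" where
  "full K n V br S \<longleftrightarrow> module_span K (V 0) {br t v | t v. t \<in> S \<and> v \<in> args n V} = carrier (V 0)"

definition fully_nondegenerate ::
    "'k ring \<Rightarrow> nat \<Rightarrow> (nat \<Rightarrow> ('k, 'v) module) \<Rightarrow> ('t \<Rightarrow> (nat \<Rightarrow> 'v) \<Rightarrow> 'v) \<Rightarrow> 't set \<Rightarrow> bool" where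
  "fully_nondegenerate K n V br S \<longleftrightarrow> nondegenerate n V br S \<and> full K n V br S"

text \<open>
  The monomial with exponents \<open>e(0), \<dots>, e(n)\<close> is the multiset over \<^term>\<open>{0..n}\<close> in which
  \<open>a\<close> has multiplicity \<open>e(a)\<close>; a polynomial is its family of coefficients.
\<close>

definition poly_ring :: "'k ring \<Rightarrow> nat \<Rightarrow> ('k, nat multiset \<Rightarrow> 'k) module" where
  "poly_ring K n = (free_module K {e. set_mset e \<subseteq> {0..n}})
     \<lparr>monoid.mult := (\<lambda>p q e. \<Oplus>\<^bsub>K\<^esub>c\<in>{c. c \<subseteq># e}. p c \<otimes>\<^bsub>K\<^esub> q (e - c)),
      one := (\<lambda>e. if e = {#} then \<one>\<^bsub>K\<^esub> else \<zero>\<^bsub>K\<^esub>)\<rparr>"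

definition var :: "'k ring \<Rightarrow> nat \<Rightarrow> nat multiset \<Rightarrow> 'k" where
  "var K a = (\<lambda>e. if e = {#a#} then \<one>\<^bsub>K\<^esub> else \<zero>\<^bsub>K\<^esub>)"

definition linear_forms :: "'k ring \<Rightarrow> nat \<Rightarrow> (nat multiset \<Rightarrow> 'k) set" where
  "linear_forms K n =
     {\<Oplus>\<^bsub>poly_ring K n\<^esub>a\<in>{0..n}. c a \<odot>\<^bsub>poly_ring K n\<^esub> var K a | c. c \<in> {0..n} \<rightarrow> carrier K}"

definition linear_homogeneous_ideal :: "'k ring \<Rightarrow> nat \<Rightarrow> (nat multiset \<Rightarrow> 'k) set \<Rightarrow> bool" where
  "linear_homogeneous_ideal K n P \<longleftrightarrow>
     (\<exists>G \<subseteq> linear_forms K n. P = Idl\<^bsub>poly_ring K n\<^esub> G)"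

definition ideal_support :: "'k ring \<Rightarrow> nat \<Rightarrow> (nat multiset \<Rightarrow> 'k) set \<Rightarrow> nat set" where
  "ideal_support K n P =
     {a \<in> {0..n}. Idl\<^bsub>K\<^esub> {p {#a#} | p. p \<in> P \<inter> linear_forms K n} = carrier K}"

definition deriv_poly :: "'k ring \<Rightarrow> nat \<Rightarrow> nat multiset \<Rightarrow> 'k" where
  "deriv_poly K n =
     var K 0 \<ominus>\<^bsub>poly_ring K n\<^esub> (\<Oplus>\<^bsub>poly_ring K n\<^esub>a\<in>{1..n}. var K a)"

text \<open>
  \<open>L \<otimes> V\<close> is the free Abelian group on \<^term>\<open>carrier L \<times> carrier V\<close> modulo the usual relations,
  and \<open>L\<close> acts through the left factor.
\<close>

definition tensor_relations ::
    "'k ring \<Rightarrow> ('k, 'l) module \<Rightarrow> ('k, 'v) module \<Rightarrow> ('l \<times> 'v \<Rightarrow>\<^sub>0 int) set" where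
  "tensor_relations K L V =
     {frag_of (l \<oplus>\<^bsub>L\<^esub> l', v) - frag_of (l, v) - frag_of (l', v) | l l' v.
        l \<in> carrier L \<and> l' \<in> carrier L \<and> v \<in> carrier V} \<union>
     {frag_of (l, v \<oplus>\<^bsub>V\<^esub> v') - frag_of (l, v) - frag_of (l, v') | l v v'.
        l \<in> carrier L \<and> v \<in> carrier V \<and> v' \<in> carrier V} \<union>
     {frag_of (k \<odot>\<^bsub>L\<^esub> l, v) - frag_of (l, k \<odot>\<^bsub>V\<^esub> v) | k l v.
        k \<in> carrier K \<and> l \<in> carrier L \<and> v \<in> carrier V}"

abbreviation tensor_free ::
    "('k, 'l) module \<Rightarrow> ('k, 'v) module \<Rightarrow> ('l \<times> 'v \<Rightarrow>\<^sub>0 int) monoid" where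
  "tensor_free L V \<equiv> free_Abelian_group (carrier L \<times> carrier V)"

definition tensor_kernel ::
    "'k ring \<Rightarrow> ('k, 'l) module \<Rightarrow> ('k, 'v) module \<Rightarrow> ('l \<times> 'v \<Rightarrow>\<^sub>0 int) set" where
  "tensor_kernel K L V = generate (tensor_free L V) (tensor_relations K L V)"

definition pure_tensor ::
    "'k ring \<Rightarrow> ('k, 'l) module \<Rightarrow> ('k, 'v) module \<Rightarrow> 'l \<Rightarrow> 'v \<Rightarrow> ('l \<times> 'v \<Rightarrow>\<^sub>0 int) set" where
  "pure_tensor K L V l v = tensor_kernel K L V #>\<^bsub>tensor_free L V\<^esub> frag_of (l, v)"

text \<open>
  The union in the definition of \<^const>\<open>smult\<close> is over the representatives \<open>x\<close> of the class \<open>C\<close>;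
  they all contribute the same class, that of \<open>\<Sum> m\<^sub>i (l l\<^sub>i \<otimes> v\<^sub>i)\<close> for \<open>x = \<Sum> m\<^sub>i (l\<^sub>i, v\<^sub>i)\<close>.
\<close>

definition base_change ::
    "'k ring \<Rightarrow> ('k, 'l) module \<Rightarrow> ('k, 'v) module \<Rightarrow> ('l, ('l \<times> 'v \<Rightarrow>\<^sub>0 int) set) module" where
  "base_change K L V =
     (let Q = tensor_free L V Mod tensor_kernel K L V in \<lparr>
        carrier = carrier Q,
        monoid.mult = undefined, one = undefined,
        ring.zero = \<one>\<^bsub>Q\<^esub>, add = (\<otimes>\<^bsub>Q\<^esub>),
        smult = (\<lambda>l C. \<Union>x\<in>C. tensor_kernel K L V #>\<^bsub>tensor_free L V\<^esub>
                   frag_extend (\<lambda>(l', v). frag_of (l \<otimes>\<^bsub>L\<^esub> l', v)) x)\<rparr>)"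

abbreviation base_change_frame ::
    "'k ring \<Rightarrow> ('k, 'l) module \<Rightarrow> (nat \<Rightarrow> ('k, 'v) module) \<Rightarrow>
      nat \<Rightarrow> ('l, ('l \<times> 'v \<Rightarrow>\<^sub>0 int) set) module" where
  "base_change_frame K L V \<equiv> (\<lambda>a. base_change K L (V a))"

text \<open>The unique \<open>L\<close>-multilinear extension of \<open>f\<close> along the maps \<open>v \<mapsto> 1 \<otimes> v\<close>.\<close>

definition multilinear_extension ::
    "'k ring \<Rightarrow> nat \<Rightarrow> (nat \<Rightarrow> ('k, 'v) module) \<Rightarrow> ('k, 'l) module \<Rightarrow> ((nat \<Rightarrow> 'v) \<Rightarrow> 'v) \<Rightarrow>
      (nat \<Rightarrow> ('l \<times> 'v \<Rightarrow>\<^sub>0 int) set) \<Rightarrow> ('l \<times> 'v \<Rightarrow>\<^sub>0 int) set" where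
  "multilinear_extension K n V L f =
     (THE g. g \<in> multilinear_maps L n (base_change_frame K L V) \<and>
        (\<forall>v\<in>args n V. g (\<lambda>a\<in>{1..n}. pure_tensor K L (V a) \<one>\<^bsub>L\<^esub> (v a)) =
           pure_tensor K L (V 0) \<one>\<^bsub>L\<^esub> (f v)))"

definition operators ::
    "'k ring \<Rightarrow> nat \<Rightarrow> (nat \<Rightarrow> ('k, 'v) module) \<Rightarrow> ('k, 'l) module \<Rightarrow>
      (nat \<Rightarrow> ('l \<times> 'v \<Rightarrow>\<^sub>0 int) set \<Rightarrow> ('l \<times> 'v \<Rightarrow>\<^sub>0 int) set) set" where
  "operators K n V L =
     (\<Pi>\<^sub>E a\<in>{0..n}. linear_maps L (base_change K L (V a)) (base_change K L (V a)))"

text \<open>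
  The value \<open>\<langle>t\<^sub>L|p(\<omega>)|w\<rangle>\<close>, where \<open>f = \<langle>t|\<close>. A coefficient in \<open>K\<close> acts on an \<open>L\<close>-module
  through its image in \<open>L\<close>.
\<close>

definition poly_action ::
    "'k ring \<Rightarrow> nat \<Rightarrow> (nat \<Rightarrow> ('k, 'v) module) \<Rightarrow> ('k, 'l) module \<Rightarrow> ((nat \<Rightarrow> 'v) \<Rightarrow> 'v) \<Rightarrow>
      (nat multiset \<Rightarrow> 'k) \<Rightarrow> (nat \<Rightarrow> ('l \<times> 'v \<Rightarrow>\<^sub>0 int) set \<Rightarrow> ('l \<times> 'v \<Rightarrow>\<^sub>0 int) set) \<Rightarrow>
      (nat \<Rightarrow> ('l \<times> 'v \<Rightarrow>\<^sub>0 int) set) \<Rightarrow> ('l \<times> 'v \<Rightarrow>\<^sub>0 int) set" where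
  "poly_action K n V L f p \<omega> w =
     (\<Oplus>\<^bsub>base_change K L (V 0)\<^esub>e\<in>{e. p e \<noteq> \<zero>\<^bsub>K\<^esub>}.
        (p e \<odot>\<^bsub>L\<^esub> \<one>\<^bsub>L\<^esub>) \<odot>\<^bsub>base_change K L (V 0)\<^esub>
          (\<omega> 0 ^^ count e 0)
            (multilinear_extension K n V L f (\<lambda>a\<in>{1..n}. (\<omega> a ^^ count e a) (w a))))"

definition annihilates ::
    "'k ring \<Rightarrow> nat \<Rightarrow> (nat \<Rightarrow> ('k, 'v) module) \<Rightarrow> ('k, 'l) module \<Rightarrow> ((nat \<Rightarrow> 'v) \<Rightarrow> 'v) \<Rightarrow>
      (nat multiset \<Rightarrow> 'k) \<Rightarrow> (nat \<Rightarrow> ('l \<times> 'v \<Rightarrow>\<^sub>0 int) set \<Rightarrow> ('l \<times> 'v \<Rightarrow>\<^sub>0 int) set) \<Rightarrow> bool" where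
  "annihilates K n V L f p \<omega> \<longleftrightarrow>
     (\<forall>w\<in>args n (base_change_frame K L V). poly_action K n V L f p \<omega> w = \<zero>\<^bsub>base_change K L (V 0)\<^esub>)"

type_synonym ('k, 'l, 'v) operator_family =
  "('k, 'l) module \<Rightarrow> (nat \<Rightarrow> ('l \<times> 'v \<Rightarrow>\<^sub>0 int) set \<Rightarrow> ('l \<times> 'v \<Rightarrow>\<^sub>0 int) set) set"

definition zero_locus ::
    "'k ring \<Rightarrow> nat \<Rightarrow> (nat \<Rightarrow> ('k, 'v) module) \<Rightarrow> ('t \<Rightarrow> (nat \<Rightarrow> 'v) \<Rightarrow> 'v) \<Rightarrow>
      't set \<Rightarrow> (nat multiset \<Rightarrow> 'k) set \<Rightarrow> ('k, 'l, 'v) operator_family" where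
  "zero_locus K n V br S P =
     (\<lambda>L. {\<omega> \<in> operators K n V L. \<forall>t\<in>S. \<forall>p\<in>P. annihilates K n V L (br t) p \<omega>})"

text \<open>
  The type \<open>'l\<close> plays the role of a universe: \<open>L\<close> ranges over all commutative \<open>K\<close>-algebras
  whose elements are taken from \<open>'l\<close> (the locale \<^locale>\<open>algebra\<close> includes commutativity).
\<close>

definition null_tensors ::
    "'k ring \<Rightarrow> nat \<Rightarrow> (nat \<Rightarrow> ('k, 'v) module) \<Rightarrow> ('k, 't) module \<Rightarrow> ('t \<Rightarrow> (nat \<Rightarrow> 'v) \<Rightarrow> 'v) \<Rightarrow>
      (nat multiset \<Rightarrow> 'k) set \<Rightarrow> ('k, 'l, 'v) operator_family \<Rightarrow> 't set" where
  "null_tensors K n V T br P \<Delta> =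
     {t \<in> carrier T. \<forall>p\<in>P. \<forall>L. algebra K L \<longrightarrow> (\<forall>\<omega>\<in>\<Delta> L. annihilates K n V L (br t) p \<omega>)}"

end

theory Submission
  imports Defs
begin

text \<open>
  Let \<open>\<omega>\<close> lie in \<open>\<^bold>Z(S, P)(L)\<close> and let \<open>\<ell> = \<Sum>\<^sub>a \<lambda>\<^sub>a x\<^sub>a\<close> be a linear form in \<open>P\<close>. Rescaling \<open>\<omega>\<close> to
  \<open>\<omega>' = (\<lambda>\<^sub>0 \<omega>\<^sub>0, -\<lambda>\<^sub>1 \<omega>\<^sub>1, \<dots>, -\<lambda>\<^sub>n \<omega>\<^sub>n)\<close> turns \<open>d\<close> into \<open>\<ell>\<close>: for every tensor \<open>t\<close>, the values
  \<open>\<langle>t\<^sub>L|d(\<omega>')\<close> and \<open>\<langle>t\<^sub>L|\<ell>(\<omega>)\<close> agree, because \<open>\<langle>t\<^sub>L|\<close> is multilinear. Hence \<open>\<omega>'\<close> lies in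
  \<open>\<^bold>Z(S, d)(L)\<close>, and a tensor \<open>t\<close> in \<open>\<^bold>N(d, \<^bold>Z(S, d))\<close> satisfies \<open>\<langle>t\<^sub>L|\<ell>(\<omega>) = 0\<close>. The polynomials
  \<open>p\<close> with \<open>\<langle>t\<^sub>L|p(\<omega>) = 0\<close> form an ideal, so \<open>t\<close> is annihilated by all of \<open>P\<close>. The existence
  of the multilinear map \<open>\<langle>t\<^sub>L|\<close> is shown by extending one argument at a time.
\<close>

section \<open>Tensor products as base changes\<close>

text \<open>Serves to show that a homomorphism sends a generated subgroup into a given subgroup: it
  is enough that the generators lie in the preimage.\<close>

lemma vimage_subgroup:
  assumes "group_hom G H h" and "subgroup I H"
  shows "subgroup {x \<in> carrier G. h x \<in> I} G"
proof -
  interpret group_hom G H h by fact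
  show ?thesis
    using subgroup.m_closed[OF assms(2)] subgroup.m_inv_closed[OF assms(2)] subgroup.one_closed[OF assms(2)]
    by unfold_locales auto
qed

locale scalar_extension = alg: algebra K L + mod: module K V
  for K :: "'k ring" and L :: "('k, 'l) module" and V :: "('k, 'v) module"
begin

abbreviation F where "F \<equiv> tensor_free L V"
abbreviation N where "N \<equiv> tensor_kernel K L V"
abbreviation B where "B \<equiv> base_change K L V"
abbreviation pure where "pure \<equiv> pure_tensor K L V"
abbreviation cls where "cls x \<equiv> N #>\<^bsub>F\<^esub> x"
abbreviation scale where "scale l \<equiv> frag_extend (\<lambda>(l', v). frag_of (l \<otimes>\<^bsub>L\<^esub> l', v))"

interpretation F: comm_group F
  by (rule abelian_free_Abelian_group)

section \<open>Cosets of the free Abelian group modulo the tensor relations\<close>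

lemma relations_in_carrier: "tensor_relations K L V \<subseteq> carrier F"
  unfolding tensor_relations_def
  by (auto simp del: carrier_free_Abelian_group_iff
      simp: frag_of_in_free_Abelian_group
      intro!: F.inv_closed) (auto dest!: subsetD[OF keys_diff])

lemma relations_in_kernel: "x \<in> tensor_relations K L V \<Longrightarrow> x \<in> N"
  unfolding tensor_kernel_def by (rule generate.incl)

lemma kernel_subgroup: "subgroup N F"
  unfolding tensor_kernel_def by (rule F.generate_is_subgroup[OF relations_in_carrier])

lemma kernel_normal: "N \<lhd> F"
  by (simp add: kernel_subgroup F.normal_iff_subgroup)

lemma kernel_subset: "N \<subseteq> carrier F"
  using kernel_subgroup by (rule subgroup.subset)

lemma cls_eqI:
  assumes "x - y \<in> N" "y \<in> carrier F"
  shows "cls x = cls y"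
proof -
  have "(x - y) \<otimes>\<^bsub>F\<^esub> y \<in> cls y"
    using assms kernel_subset by (intro F.rcosI) auto
  then have "x \<in> cls y" by simp
  then show ?thesis
    using F.repr_independence[OF _ assms(2) kernel_subgroup] by simp
qed

lemma cls_eqD:
  assumes "cls x = cls y" "x \<in> carrier F"
  shows "x - y \<in> N"
proof -
  have "x \<in> cls y"
    using F.rcos_self[OF assms(2) kernel_subgroup] assms(1) by simp
  then show ?thesis by (auto simp: r_coset_def)
qed

lemma carrier_B: "carrier B = cls ` carrier F"
  unfolding base_change_def Let_def by (simp add: carrier_FactGroup)

lemma zero_B: "\<zero>\<^bsub>B\<^esub> = cls 0"
  unfolding base_change_def Let_def
  using F.coset_mult_one[OF kernel_subset] by simp

lemma add_B:
  assumes "x \<in> carrier F" "y \<in> carrier F"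
  shows "cls x \<oplus>\<^bsub>B\<^esub> cls y = cls (x + y)"
  using normal.rcos_sum[OF kernel_normal assms]
  unfolding base_change_def Let_def by simp

lemma B_abelian_group: "abelian_group B"
proof -
  interpret Q: comm_group "F Mod N"
    by (rule F.abelian_FactGroup[OF kernel_subgroup])
  have B: "carrier B = carrier (F Mod N)" "add B = monoid.mult (F Mod N)" "\<zero>\<^bsub>B\<^esub> = \<one>\<^bsub>F Mod N\<^esub>"
    unfolding base_change_def Let_def by simp_all
  show ?thesis
  proof (rule abelian_groupI, unfold B)
    fix x assume "x \<in> carrier (F Mod N)"
    then show "\<exists>y\<in>carrier (F Mod N). y \<otimes>\<^bsub>F Mod N\<^esub> x = \<one>\<^bsub>F Mod N\<^esub>"
      by (rule Q.l_inv_ex)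
  qed (rule Q.m_closed Q.one_closed Q.m_assoc Q.m_comm Q.l_one; assumption)+
qed

interpretation B: abelian_group B
  by (rule B_abelian_group)

section \<open>The action of the algebra on cosets\<close>

lemma scale_carrier:
  assumes "l \<in> carrier L" "x \<in> carrier F"
  shows "scale l x \<in> carrier F"
  using assms keys_frag_extend[of "\<lambda>(l', v). frag_of (l \<otimes>\<^bsub>L\<^esub> l', v)" x]
  by (fastforce simp: subset_iff)

lemma scale_hom:
  assumes "l \<in> carrier L"
  shows "scale l \<in> hom F F"
  using scale_carrier[OF assms] by (auto simp: hom_def frag_extend_add simp del: carrier_free_Abelian_group_iff)

text \<open>Multiplying the left factors by \<open>l\<close> turns a relation into one of the same
  type: by distributivity in \<open>L\<close> for sums on the left, directly for sums on the right,
  and because the actions of \<open>K\<close> and \<open>L\<close> on \<open>L\<close> commute for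
  the relations that move a scalar.\<close>

lemma scale_relations:
  assumes l: "l \<in> carrier L" and x: "x \<in> tensor_relations K L V"
  shows "scale l x \<in> tensor_relations K L V"
proof -
  consider (1) a b v where "x = frag_of (a \<oplus>\<^bsub>L\<^esub> b, v) - frag_of (a, v) - frag_of (b, v)"
      "a \<in> carrier L" "b \<in> carrier L" "v \<in> carrier V"
    | (2) a v v' where "x = frag_of (a, v \<oplus>\<^bsub>V\<^esub> v') - frag_of (a, v) - frag_of (a, v')"
      "a \<in> carrier L" "v \<in> carrier V" "v' \<in> carrier V"
    | (3) k a v where "x = frag_of (k \<odot>\<^bsub>L\<^esub> a, v) - frag_of (a, k \<odot>\<^bsub>V\<^esub> v)"
      "k \<in> carrier K" "a \<in> carrier L" "v \<in> carrier V"
    using x unfolding tensor_relations_def by blast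
  then show ?thesis
  proof cases
    case 1
    have "scale l x = frag_of (l \<otimes>\<^bsub>L\<^esub> a \<oplus>\<^bsub>L\<^esub> l \<otimes>\<^bsub>L\<^esub> b, v) - frag_of (l \<otimes>\<^bsub>L\<^esub> a, v) - frag_of (l \<otimes>\<^bsub>L\<^esub> b, v)"
      using 1 l by (simp add: frag_extend_diff alg.r_distr)
    then show ?thesis
      using 1 l alg.m_closed unfolding tensor_relations_def by blast
  next
    case 2
    have "scale l x = frag_of (l \<otimes>\<^bsub>L\<^esub> a, v \<oplus>\<^bsub>V\<^esub> v') - frag_of (l \<otimes>\<^bsub>L\<^esub> a, v) - frag_of (l \<otimes>\<^bsub>L\<^esub> a, v')"
      using 2 l by (simp add: frag_extend_diff)
    then show ?thesis
      using 2 l alg.m_closed unfolding tensor_relations_def by blast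
  next
    case 3
    have "l \<otimes>\<^bsub>L\<^esub> (k \<odot>\<^bsub>L\<^esub> a) = k \<odot>\<^bsub>L\<^esub> (l \<otimes>\<^bsub>L\<^esub> a)"
      using 3 l by (metis alg.smult_assoc2 alg.smult_closed alg.m_comm)
    then have "scale l x = frag_of (k \<odot>\<^bsub>L\<^esub> (l \<otimes>\<^bsub>L\<^esub> a), v) - frag_of (l \<otimes>\<^bsub>L\<^esub> a, k \<odot>\<^bsub>V\<^esub> v)"
      using 3 by (simp add: frag_extend_diff)
    then show ?thesis
      using 3 l alg.m_closed unfolding tensor_relations_def by blast
  qed
qed

text \<open>The kernel is generated by the relations, so these alone have to be tested. With
  \<open>I = N\<close> this makes the action of \<open>L\<close> well defined; with the trivial
  subgroup it lets homomorphisms descend to the tensor product.\<close>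

lemma hom_kernel_subgroup:
  assumes "group_hom F H h" and "\<And>x. x \<in> tensor_relations K L V \<Longrightarrow> h x \<in> I" and "subgroup I H"
    and "x \<in> N"
  shows "h x \<in> I"
proof -
  have "N \<subseteq> {x \<in> carrier F. h x \<in> I}"
    unfolding tensor_kernel_def
    using assms(2) relations_in_carrier
    by (intro F.generate_subgroup_incl vimage_subgroup[OF assms(1,3)]) blast
  then show ?thesis using assms(4) by blast
qed

lemma scale_kernel:
  assumes "l \<in> carrier L" "x \<in> N"
  shows "scale l x \<in> N"
proof (rule hom_kernel_subgroup[OF _ _ kernel_subgroup assms(2)])
  show "group_hom F F (scale l)"
    using scale_hom[OF assms(1)] by (simp add: group_hom_def group_hom_axioms_def)
qed (use scale_relations[OF assms(1)] relations_in_kernel in blast)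

text \<open>Two representatives of a coset differ by an element of \<open>N\<close>, and
  \<open>scale l\<close> preserves \<open>N\<close>. The union that defines the action therefore
  ranges over equal cosets, and it is not empty because \<open>x\<close> lies in its own
  coset.\<close>

lemma smult_B:
  assumes l: "l \<in> carrier L" and x: "x \<in> carrier F"
  shows "l \<odot>\<^bsub>B\<^esub> cls x = cls (scale l x)"
proof -
  have "cls (scale l y) = cls (scale l x)" if "y \<in> cls x" for y
  proof (rule cls_eqI)
    have "y - x \<in> N" using that by (auto simp: r_coset_def)
    then show "scale l y - scale l x \<in> N"
      using scale_kernel[OF l] by (metis frag_extend_diff)
  qed (rule scale_carrier[OF l x])
  then have "(\<Union>y\<in>cls x. cls (scale l y)) = cls (scale l x)"
    using F.rcos_self[OF x kernel_subgroup] by blast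
  then show ?thesis
    unfolding base_change_def Let_def by simp
qed

section \<open>Pure tensors and the module structure\<close>

lemma pure_closed [simp, intro]:
  "l \<in> carrier L \<Longrightarrow> v \<in> carrier V \<Longrightarrow> pure l v \<in> carrier B"
  unfolding carrier_B pure_tensor_def by (intro imageI) simp

lemma pure_add_left:
  assumes "l \<in> carrier L" "l' \<in> carrier L" "v \<in> carrier V"
  shows "pure (l \<oplus>\<^bsub>L\<^esub> l') v = pure l v \<oplus>\<^bsub>B\<^esub> pure l' v"
proof -
  have "frag_of (l \<oplus>\<^bsub>L\<^esub> l', v) - frag_of (l, v) - frag_of (l', v) \<in> N"
    by (rule relations_in_kernel) (use assms in \<open>unfold tensor_relations_def, blast\<close>)
  then have "pure (l \<oplus>\<^bsub>L\<^esub> l') v = cls (frag_of (l, v) + frag_of (l', v))"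
    unfolding pure_tensor_def using assms keys_add[of "frag_of (l, v)" "frag_of (l', v)"]
    by (intro cls_eqI) (auto simp: algebra_simps)
  then show ?thesis
    unfolding pure_tensor_def using assms by (simp add: add_B)
qed

lemma pure_add_right:
  assumes "l \<in> carrier L" "v \<in> carrier V" "v' \<in> carrier V"
  shows "pure l (v \<oplus>\<^bsub>V\<^esub> v') = pure l v \<oplus>\<^bsub>B\<^esub> pure l v'"
proof -
  have "frag_of (l, v \<oplus>\<^bsub>V\<^esub> v') - frag_of (l, v) - frag_of (l, v') \<in> N"
    by (rule relations_in_kernel) (use assms in \<open>unfold tensor_relations_def, blast\<close>)
  then have "pure l (v \<oplus>\<^bsub>V\<^esub> v') = cls (frag_of (l, v) + frag_of (l, v'))"
    unfolding pure_tensor_def using assms keys_add[of "frag_of (l, v)" "frag_of (l, v')"]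
    by (intro cls_eqI) (auto simp: algebra_simps)
  then show ?thesis
    unfolding pure_tensor_def using assms by (simp add: add_B)
qed

lemma pure_smult:
  assumes "k \<in> carrier K" "l \<in> carrier L" "v \<in> carrier V"
  shows "pure (k \<odot>\<^bsub>L\<^esub> l) v = pure l (k \<odot>\<^bsub>V\<^esub> v)"
  unfolding pure_tensor_def
proof (rule cls_eqI)
  show "frag_of (k \<odot>\<^bsub>L\<^esub> l, v) - frag_of (l, k \<odot>\<^bsub>V\<^esub> v) \<in> N"
    by (rule relations_in_kernel) (use assms in \<open>unfold tensor_relations_def, blast\<close>)
qed (use assms in simp)

lemma smult_pure:
  assumes "l \<in> carrier L" "l' \<in> carrier L" "v \<in> carrier V"
  shows "l \<odot>\<^bsub>B\<^esub> pure l' v = pure (l \<otimes>\<^bsub>L\<^esub> l') v"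
  unfolding pure_tensor_def using assms by (simp add: smult_B)

text \<open>Since the negative of a pure tensor is again pure, sums of pure tensors exhaust the
  tensor product, and the induction rule below needs no case for negation.\<close>

lemma pure_uminus:
  assumes "l \<in> carrier L" "v \<in> carrier V"
  shows "pure (\<ominus>\<^bsub>L\<^esub> l) v = \<ominus>\<^bsub>B\<^esub> pure l v"
proof -
  have "pure (\<ominus>\<^bsub>L\<^esub> l) v \<oplus>\<^bsub>B\<^esub> pure l v = pure \<zero>\<^bsub>L\<^esub> v"
    using assms by (simp add: pure_add_left[symmetric] alg.M.l_neg)
  moreover have "pure \<zero>\<^bsub>L\<^esub> v = \<zero>\<^bsub>B\<^esub>"
    using pure_add_left[of "\<zero>\<^bsub>L\<^esub>" "\<zero>\<^bsub>L\<^esub>" v] assms B.add.r_cancel_one'[of "pure \<zero>\<^bsub>L\<^esub> v" "pure \<zero>\<^bsub>L\<^esub> v"]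
    by simp
  ultimately show ?thesis
    using assms by (metis B.minus_equality alg.M.a_inv_closed pure_closed)
qed

lemma B_induct [consumes 1, case_names zero pure add]:
  assumes "y \<in> carrier B"
    and zero: "P \<zero>\<^bsub>B\<^esub>"
    and pure: "\<And>l v. l \<in> carrier L \<Longrightarrow> v \<in> carrier V \<Longrightarrow> P (pure l v)"
    and add: "\<And>x y. x \<in> carrier B \<Longrightarrow> y \<in> carrier B \<Longrightarrow> P x \<Longrightarrow> P y \<Longrightarrow> P (x \<oplus>\<^bsub>B\<^esub> y)"
  shows "P y"
proof -
  obtain x where x: "x \<in> carrier F" "y = cls x"
    using assms(1) unfolding carrier_B by blast
  have "Poly_Mapping.keys x \<subseteq> carrier L \<times> carrier V" using x(1) by simp
  \<comment> \<open>Induction on the free Abelian group proceeds by differences. Carrying the class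
    of \<open>- x\<close> along turns a difference of classes into a sum, to which
    \<open>add\<close> applies.\<close>
  then have "P (cls x) \<and> P (cls (- x))"
  proof (induction x rule: free_Abelian_group_induct[consumes 1, case_names zero diff of])
    case zero
    then show ?case using assms(2) by (simp add: zero_B)
  next
    case (diff x y)
    then have c: "x \<in> carrier F" "y \<in> carrier F" "- x \<in> carrier F" "- y \<in> carrier F" by auto
    have "cls (x - y) = cls x \<oplus>\<^bsub>B\<^esub> cls (- y)" "cls (- (x - y)) = cls y \<oplus>\<^bsub>B\<^esub> cls (- x)"
      using add_B[OF c(1,4)] add_B[OF c(2,3)] by simp_all
    then show ?case
      using diff c add carrier_B by (metis (no_types, lifting) image_eqI)
  next
    case (of a)
    obtain l v where a: "a = (l, v)" "l \<in> carrier L" "v \<in> carrier V" using of by blast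
    have "cls (- frag_of a) \<oplus>\<^bsub>B\<^esub> pure l v = \<zero>\<^bsub>B\<^esub>"
      using a by (simp add: pure_tensor_def add_B zero_B)
    moreover have "cls (- frag_of a) \<in> carrier B"
      unfolding carrier_B using a by (intro imageI) simp
    ultimately have "cls (- frag_of a) = pure (\<ominus>\<^bsub>L\<^esub> l) v"
      using a by (metis B.minus_equality B.add.m_comm B.minus_minus pure_closed pure_uminus)
    then show ?case
      using a pure by (simp add: pure_tensor_def)
  qed
  then show ?thesis using x by simp
qed

lemma smult_closed_B: "l \<in> carrier L \<Longrightarrow> y \<in> carrier B \<Longrightarrow> l \<odot>\<^bsub>B\<^esub> y \<in> carrier B"
  by (auto simp: carrier_B smult_B scale_carrier simp del: carrier_free_Abelian_group_iff)

lemma smult_add_B: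
  assumes l: "l \<in> carrier L" and "x \<in> carrier B" "y \<in> carrier B"
  shows "l \<odot>\<^bsub>B\<^esub> (x \<oplus>\<^bsub>B\<^esub> y) = l \<odot>\<^bsub>B\<^esub> x \<oplus>\<^bsub>B\<^esub> l \<odot>\<^bsub>B\<^esub> y"
proof -
  obtain x' y' where x': "x' \<in> carrier F" "x = cls x'" and y': "y' \<in> carrier F" "y = cls y'"
    using assms unfolding carrier_B by blast
  have "x' + y' \<in> carrier F" using x' y' F.m_closed by fastforce
  then show ?thesis
    using x' y' l scale_carrier[OF l x'(1)] scale_carrier[OF l y'(1)]
    by (simp add: add_B smult_B frag_extend_add del: carrier_free_Abelian_group_iff)
qed

lemma smult_zero_B:
  assumes "l \<in> carrier L"
  shows "l \<odot>\<^bsub>B\<^esub> \<zero>\<^bsub>B\<^esub> = \<zero>\<^bsub>B\<^esub>"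
  using smult_B[of l 0] assms by (simp add: zero_B)

text \<open>Distributivity over sums in \<open>L\<close>, associativity and the unit law are
  compatible with addition of the module element, so they only have to be checked on pure
  tensors.\<close>

lemma B_module: "module L B"
proof (rule moduleI)
  show "cring L" by (rule alg.M_cring)
  show "abelian_group B" by (rule B_abelian_group)
  fix a b x assume a: "a \<in> carrier L" and b: "b \<in> carrier L" and x: "x \<in> carrier B"
  show "(a \<oplus>\<^bsub>L\<^esub> b) \<odot>\<^bsub>B\<^esub> x = a \<odot>\<^bsub>B\<^esub> x \<oplus>\<^bsub>B\<^esub> b \<odot>\<^bsub>B\<^esub> x"
    using x
  proof (induction x rule: B_induct)
    case (pure l v)
    then show ?case using a b by (simp add: smult_pure alg.l_distr pure_add_left)
  next
    case (add x y)
    then show ?case using a b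
      by (simp add: smult_add_B smult_closed_B B.a_ac)
  qed (use a b in \<open>simp add: smult_zero_B\<close>)
  show "(a \<otimes>\<^bsub>L\<^esub> b) \<odot>\<^bsub>B\<^esub> x = a \<odot>\<^bsub>B\<^esub> (b \<odot>\<^bsub>B\<^esub> x)"
    using x
    by (induction x rule: B_induct)
      (use a b in \<open>simp_all add: smult_zero_B smult_pure alg.m_assoc smult_add_B smult_closed_B\<close>)
next
  fix x assume "x \<in> carrier B"
  then show "\<one>\<^bsub>L\<^esub> \<odot>\<^bsub>B\<^esub> x = x"
    by (induction x rule: B_induct) (simp_all add: smult_zero_B smult_pure smult_add_B)
qed (auto simp: smult_closed_B smult_add_B)

section \<open>The universal property of extension of scalars\<close>

lemma linear_map_eqI:
  assumes "module L M" and f: "f \<in> linear_maps L B M" and g: "g \<in> linear_maps L B M"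
    and eq: "\<And>v. v \<in> carrier V \<Longrightarrow> f (pure \<one>\<^bsub>L\<^esub> v) = g (pure \<one>\<^bsub>L\<^esub> v)"
  shows "f = g"
proof (rule PiE_ext)
  interpret M: module L M by fact
  interpret BM: module L B by (rule B_module)
  show "f \<in> carrier B \<rightarrow>\<^sub>E carrier M" "g \<in> carrier B \<rightarrow>\<^sub>E carrier M"
    using f g by (simp_all add: linear_maps_def)
  \<comment> \<open>Preservation of zero is not a clause of \<open>linear_maps\<close>; it comes
    from homogeneity for the scalar zero.\<close>
  have zero: "h \<zero>\<^bsub>B\<^esub> = \<zero>\<^bsub>M\<^esub>" if "h \<in> linear_maps L B M" for h
  proof -
    have "h (\<zero>\<^bsub>L\<^esub> \<odot>\<^bsub>B\<^esub> \<zero>\<^bsub>B\<^esub>) = \<zero>\<^bsub>L\<^esub> \<odot>\<^bsub>M\<^esub> h \<zero>\<^bsub>B\<^esub>" "h \<zero>\<^bsub>B\<^esub> \<in> carrier M"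
      using that B.zero_closed alg.M.zero_closed unfolding linear_maps_def by blast+
    then show ?thesis by (simp add: smult_zero_B)
  qed
  fix y assume "y \<in> carrier B"
  then show "f y = g y"
  proof (induction y rule: B_induct)
    case (pure l v)
    \<comment> \<open>The elements \<open>1 \<otimes> v\<close> generate the tensor product over
      \<open>L\<close>, so a linear map is determined by its values there.\<close>
    have "pure l v = l \<odot>\<^bsub>B\<^esub> pure \<one>\<^bsub>L\<^esub> v"
      using pure by (simp add: smult_pure)
    then show ?case
      using f g eq[OF pure(2)] pure by (simp add: linear_maps_def)
  next
    case (add x y)
    then show ?case using f g by (simp add: linear_maps_def)
  qed (simp add: zero f g)
qed

text \<open>Linearity over \<open>L\<close> forces \<open>l \<otimes> v\<close> to go to
  \<open>l\<close> times \<open>h v\<close>. This prescription defines a homomorphism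
  \<open>u\<close> on the free Abelian group. It kills the three types of relations by
  distributivity in \<open>M\<close>, by \<open>h_add\<close> and by \<open>h_smult\<close>
  respectively, and so descends to the quotient.\<close>

lemma linear_map_exists:
  assumes "module L M" and h: "h \<in> carrier V \<rightarrow> carrier M"
    and h_add: "\<And>x y. x \<in> carrier V \<Longrightarrow> y \<in> carrier V \<Longrightarrow> h (x \<oplus>\<^bsub>V\<^esub> y) = h x \<oplus>\<^bsub>M\<^esub> h y"
    and h_smult: "\<And>k x. k \<in> carrier K \<Longrightarrow> x \<in> carrier V \<Longrightarrow>
      h (k \<odot>\<^bsub>V\<^esub> x) = (k \<odot>\<^bsub>L\<^esub> \<one>\<^bsub>L\<^esub>) \<odot>\<^bsub>M\<^esub> h x"
  obtains g where "g \<in> linear_maps L B M" "\<And>v. v \<in> carrier V \<Longrightarrow> g (pure \<one>\<^bsub>L\<^esub> v) = h v"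
proof -
  interpret M: module L M by fact
  interpret BM: module L B by (rule B_module)
  have "(\<lambda>(l, v). l \<odot>\<^bsub>M\<^esub> h v) ` (carrier L \<times> carrier V) \<subseteq> carrier (add_monoid M)"
    using h by auto
  then obtain u where u: "u \<in> hom F (add_monoid M)"
    and u_of: "\<And>x. x \<in> carrier L \<times> carrier V \<Longrightarrow> u (frag_of x) = (\<lambda>(l, v). l \<odot>\<^bsub>M\<^esub> h v) x"
    using comm_group.free_Abelian_group_universal[OF M.a_comm_group] by metis
  interpret u: group_hom F "add_monoid M" u
    using u by (simp add: group_hom_def group_hom_axioms_def M.a_group)
  have u_closed: "u x \<in> carrier M" if "x \<in> carrier F" for x
    using u.hom_closed[OF that] by simp
  have u_add: "u (x + y) = u x \<oplus>\<^bsub>M\<^esub> u y" if "x \<in> carrier F" "y \<in> carrier F" for x y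
    using u.hom_mult[OF that] by simp
  have u_minus: "u (x - y) = u x \<ominus>\<^bsub>M\<^esub> u y" if xy: "x \<in> carrier F" "y \<in> carrier F" for x y
  proof -
    have "x - y \<in> carrier F" using xy keys_diff[of x y] by auto
    then have "u ((x - y) + y) = u (x - y) \<oplus>\<^bsub>M\<^esub> u y" "u (x - y) \<in> carrier M"
      "u x \<in> carrier M" "u y \<in> carrier M"
      by (rule u_add[OF _ xy(2)], rule u_closed) (rule u_closed[OF xy(1)], rule u_closed[OF xy(2)])
    then show ?thesis by (simp add: a_minus_def M.M.add.inv_solve_right)
  qed
  have u_rel: "u x \<in> {\<zero>\<^bsub>M\<^esub>}" if x: "x \<in> tensor_relations K L V" for x
  proof -
    consider (1) a b v where "x = frag_of (a \<oplus>\<^bsub>L\<^esub> b, v) - frag_of (a, v) - frag_of (b, v)"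
        "a \<in> carrier L" "b \<in> carrier L" "v \<in> carrier V"
      | (2) a v v' where "x = frag_of (a, v \<oplus>\<^bsub>V\<^esub> v') - frag_of (a, v) - frag_of (a, v')"
        "a \<in> carrier L" "v \<in> carrier V" "v' \<in> carrier V"
      | (3) k a v where "x = frag_of (k \<odot>\<^bsub>L\<^esub> a, v) - frag_of (a, k \<odot>\<^bsub>V\<^esub> v)"
        "k \<in> carrier K" "a \<in> carrier L" "v \<in> carrier V"
      using x unfolding tensor_relations_def by blast
    then show ?thesis
    proof cases
      case 1
      then have hv: "h v \<in> carrier M" using h by blast
      have "x = frag_of (a \<oplus>\<^bsub>L\<^esub> b, v) - (frag_of (a, v) + frag_of (b, v))"
        using 1 by simp
      moreover have "frag_of (a, v) + frag_of (b, v) \<in> carrier F"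
        using 1 F.m_closed[of "frag_of (a, v)" "frag_of (b, v)"] by simp
      ultimately have "u x = u (frag_of (a \<oplus>\<^bsub>L\<^esub> b, v)) \<ominus>\<^bsub>M\<^esub> (u (frag_of (a, v)) \<oplus>\<^bsub>M\<^esub> u (frag_of (b, v)))"
        using 1 by (simp only: u_minus u_add frag_of_in_free_Abelian_group mem_Times_iff fst_conv snd_conv alg.M.a_closed)
      then show ?thesis
        using 1(2-4) hv by (simp add: u_of M.smult_l_distr a_minus_def M.M.r_neg)
    next
      case 2
      then have hv: "h v \<in> carrier M" "h v' \<in> carrier M" using h by blast+
      have "x = frag_of (a, v \<oplus>\<^bsub>V\<^esub> v') - (frag_of (a, v) + frag_of (a, v'))"
        using 2 by simp
      moreover have "frag_of (a, v) + frag_of (a, v') \<in> carrier F"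
        using 2 F.m_closed[of "frag_of (a, v)" "frag_of (a, v')"] by simp
      ultimately have "u x = u (frag_of (a, v \<oplus>\<^bsub>V\<^esub> v')) \<ominus>\<^bsub>M\<^esub> (u (frag_of (a, v)) \<oplus>\<^bsub>M\<^esub> u (frag_of (a, v')))"
        using 2 by (simp only: u_minus u_add frag_of_in_free_Abelian_group mem_Times_iff fst_conv snd_conv mod.M.a_closed)
      then show ?thesis
        using 2(2-4) hv by (simp add: u_of h_add M.smult_r_distr a_minus_def M.M.r_neg)
    next
      case 3
      then have hv: "h v \<in> carrier M" using h by blast
      \<comment> \<open>The scalar \<open>k\<close> is replaced by its image in \<open>L\<close>,
        the form in which \<open>h_smult\<close> passes it through \<open>h\<close>.\<close>
      have "k \<odot>\<^bsub>L\<^esub> a = a \<otimes>\<^bsub>L\<^esub> (k \<odot>\<^bsub>L\<^esub> \<one>\<^bsub>L\<^esub>)"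
        using 3 by (metis alg.smult_assoc2 alg.m_comm alg.one_closed alg.smult_closed alg.l_one)
      then show ?thesis
        using 3 hv by (simp add: u_minus u_of h_smult M.smult_assoc1 a_minus_def M.M.r_neg)
    qed
  qed
  have u_kernel: "u x = \<zero>\<^bsub>M\<^esub>" if "x \<in> N" for x
    using hom_kernel_subgroup[OF u.group_hom_axioms u_rel _ that]
      group.triv_subgroup[OF M.a_group] by simp
  have "u x = u y" if "x \<in> carrier F" "y \<in> carrier F" "cls x = cls y" for x y
    using u_kernel[OF cls_eqD[OF that(3,1)]] u_minus[OF that(1,2)] u_closed[OF that(1)] u_closed[OF that(2)]
    by (simp add: M.M.add.inv_solve_right' a_minus_def)
  then obtain g where g_hom: "g \<in> hom (F Mod N) (add_monoid M)"
    and g: "\<And>x. x \<in> carrier F \<Longrightarrow> g (cls x) = u x"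
    using FactGroup_universal[OF u kernel_normal] by metis
  have g_hom': "g \<in> hom (add_monoid B) (add_monoid M)"
    using g_hom unfolding base_change_def Let_def by (simp add: hom_def)
  have g_closed: "g x \<in> carrier M" if "x \<in> carrier B" for x
    using g_hom' that by (auto simp: hom_def)
  have g_add: "g (x \<oplus>\<^bsub>B\<^esub> y) = g x \<oplus>\<^bsub>M\<^esub> g y" if "x \<in> carrier B" "y \<in> carrier B" for x y
    using g_hom' that by (auto simp: hom_def)
  have g_pure: "g (pure l v) = l \<odot>\<^bsub>M\<^esub> h v" if "l \<in> carrier L" "v \<in> carrier V" for l v
    using that by (simp add: pure_tensor_def g u_of)
  have g_zero: "g \<zero>\<^bsub>B\<^esub> = \<zero>\<^bsub>M\<^esub>"
    using g[of 0] u.hom_one by (simp add: zero_B)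
  have g_smult: "g (l \<odot>\<^bsub>B\<^esub> y) = l \<odot>\<^bsub>M\<^esub> g y" if l: "l \<in> carrier L" and "y \<in> carrier B" for l y
    using that(2)
  proof (induction y rule: B_induct)
    case (pure l' v)
    then have "h v \<in> carrier M" using h by blast
    then show ?case using pure l by (simp add: smult_pure g_pure M.smult_assoc1)
  qed (use l in \<open>simp_all add: g_zero g_add g_closed BM.smult_r_distr M.smult_r_distr\<close>)
  show thesis
  proof (rule that)
    \<comment> \<open>The map obtained from the quotient may take any values off the carrier,
      whereas \<open>linear_maps\<close> asks for extensional functions.\<close>
    show "restrict g (carrier B) \<in> linear_maps L B M"
      by (auto simp: linear_maps_def g_closed g_add g_smult)
    fix v assume "v \<in> carrier V"
    then show "restrict g (carrier B) (pure \<one>\<^bsub>L\<^esub> v) = h v"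
      using h by (simp add: g_pure Pi_iff)
  qed
qed

end

section \<open>Multivariate polynomials and their evaluation in modules\<close>

lemma (in abelian_monoid) finsum_Sigma:
  assumes "finite A" "\<And>a. a \<in> A \<Longrightarrow> finite (B a)"
    and "\<And>a b. a \<in> A \<Longrightarrow> b \<in> B a \<Longrightarrow> f (a, b) \<in> carrier G"
  shows "finsum G f (Sigma A B) = (\<Oplus>a\<in>A. \<Oplus>b\<in>B a. f (a, b))"
proof -
  have "finsum G f (\<Union>a\<in>A. Pair a ` B a) = (\<Oplus>a\<in>A. finsum G f (Pair a ` B a))"
    using assms by (intro add.finprod_UN_disjoint) (auto simp: pairwise_def disjnt_def)
  also have "\<dots> = (\<Oplus>a\<in>A. \<Oplus>b\<in>B a. f (a, b))"
    using assms by (intro finsum_cong') (auto intro!: finsum_closed finsum_reindex simp: inj_on_def)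
  also have "(\<Union>a\<in>A. Pair a ` B a) = Sigma A B" by auto
  finally show ?thesis .
qed

lemma (in module) finsum_smult_rdistr:
  assumes "finite A" "f \<in> A \<rightarrow> carrier R" "x \<in> carrier M"
  shows "(\<Oplus>i\<in>A. f i) \<odot>\<^bsub>M\<^esub> x = (\<Oplus>\<^bsub>M\<^esub>i\<in>A. f i \<odot>\<^bsub>M\<^esub> x)"
  using assms by (induction A rule: finite_induct) (simp_all add: Pi_def smult_l_distr)

text \<open>Used to bound supports: a nonzero coefficient of a sum or a product must come from some
  nonzero term.\<close>

lemma (in abelian_monoid) finsum_nonzeroE:
  assumes "finsum G f A \<noteq> \<zero>"
  obtains a where "a \<in> A" "f a \<noteq> \<zero>"
  using assms add.finprod_one_eqI[of A f] by blast

lemma (in abelian_monoid) finsum_bij_betw: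
  assumes "bij_betw h A B" "f \<in> B \<rightarrow> carrier G"
  shows "finsum G f B = (\<Oplus>a\<in>A. f (h a))"
  using finsum_reindex[of f h A] assms by (simp add: bij_betw_def)

text \<open>A submultiset of \<open>add_mset a e\<close> that contains \<open>a\<close> leaves a
  submultiset of \<open>e\<close> when one copy of \<open>a\<close> is removed; one that does not
  contain \<open>a\<close> is itself a submultiset of \<open>e\<close>.\<close>

lemma finite_submultisets: "finite {c. c \<subseteq># e}"
proof (induction e)
  case (add a e)
  have "{c. c \<subseteq># add_mset a e} \<subseteq> {c. c \<subseteq># e} \<union> add_mset a ` {c. c \<subseteq># e}"
  proof
    fix c assume c: "c \<in> {c. c \<subseteq># add_mset a e}"
    show "c \<in> {c. c \<subseteq># e} \<union> add_mset a ` {c. c \<subseteq># e}"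
    proof (cases "a \<in># c")
      case True
      then obtain c' where "c = add_mset a c'" by (meson mset_add)
      then show ?thesis using c by simp
    next
      case False
      then show ?thesis using c
        by (auto simp: subseteq_mset_def not_in_iff split: if_splits) (metis le0)
    qed
  qed
  then show ?case using add by (simp add: finite_subset)
qed simp

text \<open>A symmetric index set for the convolution product, in place of pairs \<open>c\<close>,
  \<open>e - c\<close> with truncated subtraction. It makes commutativity and associativity of the
  product a matter of reindexing.\<close>

definition decompositions :: "'a multiset \<Rightarrow> ('a multiset \<times> 'a multiset) set" where
  "decompositions e = {(c, d). c + d = e}"

lemma bij_betw_decompositions: "bij_betw (\<lambda>c. (c, e - c)) {c. c \<subseteq># e} (decompositions e)"
  unfolding decompositions_def bij_betw_def inj_on_def
  by (auto simp: image_iff)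

lemma finite_decompositions [simp]: "finite (decompositions e)"
  using bij_betw_finite[OF bij_betw_decompositions] finite_submultisets by blast

section \<open>The polynomial ring as a convolution algebra\<close>

locale polynomials = cring K for K :: "'k ring" (structure) +
  fixes n :: nat
begin

abbreviation R where "R \<equiv> poly_ring K n"
abbreviation supp where "supp p \<equiv> {e. p e \<noteq> \<zero>}"

lemma carrier_R: "carrier R = {f. (\<forall>e. f e \<in> carrier K) \<and> (\<forall>e\<in>supp f. set_mset e \<subseteq> {0..n}) \<and> finite (supp f)}"
  by (auto simp: poly_ring_def free_module_def)

lemma R_simps:
  "\<zero>\<^bsub>R\<^esub> = (\<lambda>e. \<zero>)" "p \<oplus>\<^bsub>R\<^esub> q = (\<lambda>e. p e \<oplus> q e)" "k \<odot>\<^bsub>R\<^esub> p = (\<lambda>e. k \<otimes> p e)"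
  "\<one>\<^bsub>R\<^esub> = (\<lambda>e. if e = {#} then \<one> else \<zero>)"
  by (simp_all add: poly_ring_def free_module_def)

lemma coeff_closed: "p \<in> carrier R \<Longrightarrow> p e \<in> carrier K"
  by (simp add: carrier_R)

lemma mult_R:
  assumes "p \<in> carrier R" "q \<in> carrier R"
  shows "(p \<otimes>\<^bsub>R\<^esub> q) e = (\<Oplus>x\<in>decompositions e. p (fst x) \<otimes> q (snd x))"
  using assms
  by (subst finsum_bij_betw[OF bij_betw_decompositions])
    (auto simp: poly_ring_def coeff_closed)

lemma carrier_R_I:
  assumes "\<And>e. f e \<in> carrier K" "\<And>e. f e \<noteq> \<zero> \<Longrightarrow> set_mset e \<subseteq> {0..n} \<and> e \<in> A" "finite A"
  shows "f \<in> carrier R"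
  using assms finite_subset[of "supp f" A] by (auto simp: carrier_R)

lemma R_abelian_group: "abelian_group R"
proof (rule abelian_groupI)
  fix p q assume p: "p \<in> carrier R" and q: "q \<in> carrier R"
  show "p \<oplus>\<^bsub>R\<^esub> q \<in> carrier R"
  proof (rule carrier_R_I[where A = "supp p \<union> supp q"])
    fix e assume "(p \<oplus>\<^bsub>R\<^esub> q) e \<noteq> \<zero>"
    then have "p e \<noteq> \<zero> \<or> q e \<noteq> \<zero>" by (auto simp: R_simps)
    then show "set_mset e \<subseteq> {0..n} \<and> e \<in> supp p \<union> supp q" using p q by (auto simp: carrier_R)
  qed (use p q in \<open>auto simp: carrier_R R_simps\<close>)
next
  fix p assume p: "p \<in> carrier R"
  have "(\<lambda>e. \<ominus> p e) \<in> carrier R"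
    by (rule carrier_R_I[where A = "supp p"]) (use p in \<open>auto simp: carrier_R\<close>)
  then show "\<exists>q\<in>carrier R. q \<oplus>\<^bsub>R\<^esub> p = \<zero>\<^bsub>R\<^esub>"
    by (rule bexI[rotated]) (use p in \<open>simp add: R_simps coeff_closed l_neg\<close>)
qed (auto simp: R_simps carrier_R a_ac)

sublocale R: abelian_group R
  by (rule R_abelian_group)

lemma mult_closed_R:
  assumes p: "p \<in> carrier R" and q: "q \<in> carrier R"
  shows "p \<otimes>\<^bsub>R\<^esub> q \<in> carrier R"
proof (rule carrier_R_I[where A = "(\<lambda>(c, d). c + d) ` (supp p \<times> supp q)"])
  fix e
  show "(p \<otimes>\<^bsub>R\<^esub> q) e \<in> carrier K"
    unfolding mult_R[OF assms] using assms by (auto intro!: finsum_closed simp: coeff_closed)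
  assume "(p \<otimes>\<^bsub>R\<^esub> q) e \<noteq> \<zero>"
  then have "(\<Oplus>x\<in>decompositions e. p (fst x) \<otimes> q (snd x)) \<noteq> \<zero>"
    using assms by (simp add: mult_R)
  then obtain c d where "c + d = e" "p c \<otimes> q d \<noteq> \<zero>"
    by (auto elim!: finsum_nonzeroE simp: decompositions_def)
  then have "c + d = e" "p c \<noteq> \<zero>" "q d \<noteq> \<zero>"
    using assms by (auto simp: coeff_closed)
  moreover from this have "set_mset c \<subseteq> {0..n}" "set_mset d \<subseteq> {0..n}" using p q by (auto simp: carrier_R)
  ultimately show "set_mset e \<subseteq> {0..n} \<and> e \<in> (\<lambda>(c, d). c + d) ` (supp p \<times> supp q)"
    by (auto simp: subset_iff)
qed (use p q in \<open>auto simp: carrier_R\<close>)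

lemma mult_comm_R:
  assumes p: "p \<in> carrier R" and q: "q \<in> carrier R"
  shows "p \<otimes>\<^bsub>R\<^esub> q = q \<otimes>\<^bsub>R\<^esub> p"
proof
  fix e :: "nat multiset"
  have "bij_betw prod.swap (decompositions e) (decompositions e)"
    by (auto simp: bij_betw_def decompositions_def image_iff ac_simps)
  from finsum_bij_betw[OF this, of "\<lambda>x. p (fst x) \<otimes> q (snd x)"]
  show "(p \<otimes>\<^bsub>R\<^esub> q) e = (q \<otimes>\<^bsub>R\<^esub> p) e"
    using assms by (simp add: mult_R coeff_closed split_beta Pi_def m_comm)
qed

text \<open>Both bracketings are sums over the decompositions of \<open>e\<close> into three parts;
  they differ only in which two parts are first taken together.\<close>

lemma mult_assoc_R:
  assumes p: "p \<in> carrier R" and q: "q \<in> carrier R" and r: "r \<in> carrier R"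
  shows "(p \<otimes>\<^bsub>R\<^esub> q) \<otimes>\<^bsub>R\<^esub> r = p \<otimes>\<^bsub>R\<^esub> (q \<otimes>\<^bsub>R\<^esub> r)"
proof
  fix e :: "nat multiset"
  note pqr [simp] = coeff_closed[OF p] coeff_closed[OF q] coeff_closed[OF r]
  let ?D = "decompositions e"
  have "((p \<otimes>\<^bsub>R\<^esub> q) \<otimes>\<^bsub>R\<^esub> r) e = (\<Oplus>x\<in>?D. (p \<otimes>\<^bsub>R\<^esub> q) (fst x) \<otimes> r (snd x))"
    using assms by (simp add: mult_R mult_closed_R split_beta)
  also have "\<dots> = (\<Oplus>x\<in>?D. \<Oplus>y\<in>decompositions (fst x). p (fst y) \<otimes> q (snd y) \<otimes> r (snd x))"
    using assms by (intro finsum_cong') (auto simp: mult_R split_beta intro!: finsum_ldistr finsum_closed)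
  also have "\<dots> = (\<Oplus>z\<in>(SIGMA x:?D. decompositions (fst x)). p (fst (snd z)) \<otimes> q (snd (snd z)) \<otimes> r (snd (fst z)))"
    by (subst finsum_Sigma) auto
  also have "\<dots> = (\<Oplus>z\<in>(SIGMA x:?D. decompositions (snd x)). p (fst (fst z)) \<otimes> (q (fst (snd z)) \<otimes> r (snd (snd z))))"
  proof -
    \<comment> \<open>The pair \<open>(a, b + c)\<close> with its second entry split into
      \<open>(b, c)\<close> is matched with \<open>(a + b, c)\<close> whose first entry is split
      into \<open>(a, b)\<close>.\<close>
    have "bij_betw (\<lambda>(x, y). ((fst x + fst y, snd y), (fst x, fst y)))
        (SIGMA x:?D. decompositions (snd x)) (SIGMA x:?D. decompositions (fst x))"
      by (rule bij_betw_byWitness[where f' = "\<lambda>(x, y). ((fst y, snd y + snd x), (snd y, snd x))"])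
        (auto simp: decompositions_def ac_simps)
    from finsum_bij_betw[OF this, of "\<lambda>z. p (fst (snd z)) \<otimes> q (snd (snd z)) \<otimes> r (snd (fst z))"]
    show ?thesis by (simp add: split_beta Pi_def m_assoc)
  qed
  also have "\<dots> = (\<Oplus>x\<in>?D. \<Oplus>y\<in>decompositions (snd x). p (fst x) \<otimes> (q (fst y) \<otimes> r (snd y)))"
    by (subst finsum_Sigma) auto
  also have "\<dots> = (\<Oplus>x\<in>?D. p (fst x) \<otimes> (q \<otimes>\<^bsub>R\<^esub> r) (snd x))"
    using assms by (intro finsum_cong') (auto simp: mult_R split_beta intro!: finsum_rdistr[symmetric] finsum_closed)
  also have "\<dots> = (p \<otimes>\<^bsub>R\<^esub> (q \<otimes>\<^bsub>R\<^esub> r)) e"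
    using assms by (simp add: mult_R mult_closed_R split_beta)
  finally show "((p \<otimes>\<^bsub>R\<^esub> q) \<otimes>\<^bsub>R\<^esub> r) e = (p \<otimes>\<^bsub>R\<^esub> (q \<otimes>\<^bsub>R\<^esub> r)) e" .
qed

lemma one_closed_R: "\<one>\<^bsub>R\<^esub> \<in> carrier R"
  by (rule carrier_R_I[where A = "{{#}}"]) (auto simp: R_simps split: if_splits)

lemma one_mult_R:
  assumes p: "p \<in> carrier R"
  shows "\<one>\<^bsub>R\<^esub> \<otimes>\<^bsub>R\<^esub> p = p"
proof
  fix e
  have "(\<one>\<^bsub>R\<^esub> \<otimes>\<^bsub>R\<^esub> p) e = (\<Oplus>x\<in>decompositions e. \<one>\<^bsub>R\<^esub> (fst x) \<otimes> p (snd x))"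
    using p one_closed_R by (simp add: mult_R split_beta)
  also have "\<dots> = (\<Oplus>x\<in>decompositions e. if ({#}, e) = x then p (snd x) else \<zero>)"
    using p by (intro finsum_cong') (auto simp: R_simps decompositions_def coeff_closed)
  also have "\<dots> = p e"
    using p finite_decompositions[of e] by (subst add.finprod_singleton) (auto simp: decompositions_def coeff_closed)
  finally show "(\<one>\<^bsub>R\<^esub> \<otimes>\<^bsub>R\<^esub> p) e = p e" .
qed

lemma distrib_R:
  assumes p: "p \<in> carrier R" and q: "q \<in> carrier R" and r: "r \<in> carrier R"
  shows "(p \<oplus>\<^bsub>R\<^esub> q) \<otimes>\<^bsub>R\<^esub> r = p \<otimes>\<^bsub>R\<^esub> r \<oplus>\<^bsub>R\<^esub> q \<otimes>\<^bsub>R\<^esub> r"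
proof
  fix e :: "nat multiset"
  note pqr [simp] = coeff_closed[OF p] coeff_closed[OF q] coeff_closed[OF r]
  have "((p \<oplus>\<^bsub>R\<^esub> q) \<otimes>\<^bsub>R\<^esub> r) e = (\<Oplus>x\<in>decompositions e. p (fst x) \<otimes> r (snd x) \<oplus> q (fst x) \<otimes> r (snd x))"
    using R.add.m_closed[OF p q] r by (simp add: mult_R split_beta R_simps l_distr)
  also have "\<dots> = (p \<otimes>\<^bsub>R\<^esub> r) e \<oplus> (q \<otimes>\<^bsub>R\<^esub> r) e"
    using assms by (subst finsum_addf) (auto simp: mult_R split_beta)
  finally show "((p \<oplus>\<^bsub>R\<^esub> q) \<otimes>\<^bsub>R\<^esub> r) e = (p \<otimes>\<^bsub>R\<^esub> r \<oplus>\<^bsub>R\<^esub> q \<otimes>\<^bsub>R\<^esub> r) e"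
    by (simp add: R_simps)
qed

lemma R_cring: "cring R"
  by (intro cringI R_abelian_group comm_monoidI)
    (auto simp: mult_closed_R one_closed_R mult_assoc_R one_mult_R distrib_R intro: mult_comm_R)

sublocale R: cring R
  by (rule R_cring)

lemma finsum_R:
  assumes "finite A" "f \<in> A \<rightarrow> carrier R"
  shows "(\<Oplus>\<^bsub>R\<^esub>a\<in>A. f a) e = (\<Oplus>a\<in>A. f a e)"
  using assms
proof (induction A rule: finite_induct)
  case empty
  then show ?case by (simp add: R_simps)
next
  case (insert a A)
  then have f: "f a \<in> carrier R" "f \<in> A \<rightarrow> carrier R" by auto
  then have "(\<lambda>a. f a e) \<in> A \<rightarrow> carrier K" by (auto intro!: coeff_closed)
  then show ?case using insert(1-3) f by (simp add: R.finsum_insert finsum_insert R_simps coeff_closed)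
qed

section \<open>Linear forms and the coefficients of \<open>deriv_poly\<close>\<close>

lemma smult_var_closed: "a \<le> n \<Longrightarrow> k \<in> carrier K \<Longrightarrow> k \<odot>\<^bsub>R\<^esub> var K a \<in> carrier R"
  by (rule carrier_R_I[where A = "{{#a#}}"]) (auto simp: R_simps var_def split: if_splits)

lemma var_closed: "a \<le> n \<Longrightarrow> var K a \<in> carrier R"
  by (rule carrier_R_I[where A = "{{#a#}}"]) (auto simp: var_def split: if_splits)

lemma linear_formsE:
  assumes "p \<in> linear_forms K n"
  shows "p \<in> carrier R" "\<And>e. p e \<noteq> \<zero> \<Longrightarrow> e \<in> (\<lambda>a. {#a#}) ` {0..n}"
proof -
  obtain c where p: "p = (\<Oplus>\<^bsub>R\<^esub>a\<in>{0..n}. c a \<odot>\<^bsub>R\<^esub> var K a)" and c: "c \<in> {0..n} \<rightarrow> carrier K"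
    using assms unfolding linear_forms_def by blast
  have cl: "(\<lambda>a. c a \<odot>\<^bsub>R\<^esub> var K a) \<in> {0..n} \<rightarrow> carrier R"
    using c by (auto intro!: smult_var_closed)
  then show "p \<in> carrier R" unfolding p by (rule R.finsum_closed)
  fix e assume "p e \<noteq> \<zero>"
  then have "(\<Oplus>a\<in>{0..n}. c a \<otimes> var K a e) \<noteq> \<zero>"
    using finsum_R[OF _ cl] by (simp add: p R_simps)
  then obtain a where "a \<in> {0..n}" "c a \<otimes> var K a e \<noteq> \<zero>"
    by (rule finsum_nonzeroE)
  then show "e \<in> (\<lambda>a. {#a#}) ` {0..n}"
    using c by (auto simp: var_def Pi_iff split: if_splits)
qed

lemma deriv_poly_closed: "deriv_poly K n \<in> carrier R"
  unfolding deriv_poly_def by (intro R.minus_closed R.finsum_closed) (auto intro: var_closed)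

lemma deriv_poly_coeff:
  "deriv_poly K n e = (if e = {#0#} then \<one> else if \<exists>a\<in>{1..n}. e = {#a#} then \<ominus> \<one> else \<zero>)"
proof -
  let ?s = "\<Oplus>\<^bsub>R\<^esub>a\<in>{1..n}. var K a"
  have s: "?s e = (if \<exists>a\<in>{1..n}. e = {#a#} then \<one> else \<zero>)" for e
  proof -
    have "?s e = (\<Oplus>a\<in>{1..n}. var K a e)"
      by (rule finsum_R) (auto intro: var_closed)
    also have "\<dots> = (if \<exists>a\<in>{1..n}. e = {#a#} then \<one> else \<zero>)"
    proof (cases "\<exists>a\<in>{1..n}. e = {#a#}")
      case True
      then obtain a where a: "a \<in> {1..n}" "e = {#a#}" by blast
      then have "(\<Oplus>a\<in>{1..n}. var K a e) = (\<Oplus>b\<in>{1..n}. if a = b then \<one> else \<zero>)"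
        by (intro finsum_cong') (auto simp: var_def)
      also have "\<dots> = \<one>" using a by (subst add.finprod_singleton) auto
      finally show ?thesis using True by simp
    next
      case False
      then show ?thesis by (auto intro!: add.finprod_one_eqI simp: var_def)
    qed
    finally show ?thesis .
  qed
  have sc: "?s \<in> carrier R" by (rule R.finsum_closed) (auto intro: var_closed)
  \<comment> \<open>Negation of polynomials is given only as the additive inverse in the ring, so
    its coefficients are identified by uniqueness of inverses in \<open>K\<close>.\<close>
  have "(\<ominus>\<^bsub>R\<^esub> ?s) e \<oplus> ?s e = \<zero>"
    using R.l_neg[OF sc] by (simp add: R_simps fun_eq_iff)
  then have "(\<ominus>\<^bsub>R\<^esub> ?s) e = \<ominus> ?s e"
    using coeff_closed[OF sc] coeff_closed[OF R.a_inv_closed[OF sc]] by (metis minus_equality)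
  then show ?thesis
    unfolding deriv_poly_def a_minus_def by (simp only: R_simps(2) s) (auto simp: var_def)
qed

end

section \<open>Evaluation of polynomials with values in a module\<close>

locale polynomial_evaluation = polynomials K n + M: module L M
  for K :: "'k ring" and n :: nat and L :: "('l, 'x) ring_scheme" and M :: "('l, 'm, 'y) module_scheme" +
  fixes \<phi> :: "'k \<Rightarrow> 'l"
  assumes \<phi>_hom: "\<phi> \<in> ring_hom K L"
begin

text \<open>The additive map that sends the monomial \<open>e\<close> to \<open>m e\<close>, with
  coefficients acting through \<open>\<phi>\<close>. The family \<open>m\<close> is left arbitrary,
  so that shifted families such as \<open>\<lambda>d. m (c + d)\<close> can be evaluated as well;
  products require this.\<close>

definition evaluation where
  "evaluation m p = (\<Oplus>\<^bsub>M\<^esub>e\<in>supp p. \<phi> (p e) \<odot>\<^bsub>M\<^esub> m e)"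

sublocale \<phi>: ring_hom_cring K L \<phi>
  using \<phi>_hom by (simp add: ring_hom_cring_def ring_hom_cring_axioms_def cring_axioms M.R.cring_axioms)

text \<open>Terms off the support vanish because \<open>\<phi>\<close> preserves zero. Polynomials
  with different supports can thus be summed over a common index set.\<close>

lemma evaluation_superset:
  assumes "p \<in> carrier R" "m \<in> A \<rightarrow> carrier M" "finite A" "supp p \<subseteq> A"
  shows "evaluation m p = (\<Oplus>\<^bsub>M\<^esub>e\<in>A. \<phi> (p e) \<odot>\<^bsub>M\<^esub> m e)"
  unfolding evaluation_def
  using assms by (intro M.M.add.finprod_mono_neutral_cong_left) (auto simp: coeff_closed Pi_iff)

lemma evaluation_zero: "evaluation m \<zero>\<^bsub>R\<^esub> = \<zero>\<^bsub>M\<^esub>"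
  unfolding evaluation_def by (simp add: R_simps)

lemma evaluation_add:
  assumes p: "p \<in> carrier R" and q: "q \<in> carrier R" and m: "m \<in> UNIV \<rightarrow> carrier M"
  shows "evaluation m (p \<oplus>\<^bsub>R\<^esub> q) = evaluation m p \<oplus>\<^bsub>M\<^esub> evaluation m q"
proof -
  let ?A = "supp p \<union> supp q"
  have mA: "m \<in> ?A \<rightarrow> carrier M" using m by auto
  have fin: "finite ?A" using p q by (auto simp: carrier_R)
  have "evaluation m (p \<oplus>\<^bsub>R\<^esub> q) = (\<Oplus>\<^bsub>M\<^esub>e\<in>?A. \<phi> ((p \<oplus>\<^bsub>R\<^esub> q) e) \<odot>\<^bsub>M\<^esub> m e)"
    using p q mA fin by (intro evaluation_superset R.a_closed) (auto simp: R_simps)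
  also have "\<dots> = (\<Oplus>\<^bsub>M\<^esub>e\<in>?A. \<phi> (p e) \<odot>\<^bsub>M\<^esub> m e \<oplus>\<^bsub>M\<^esub> \<phi> (q e) \<odot>\<^bsub>M\<^esub> m e)"
    using p q m by (intro M.M.finsum_cong') (auto simp: R_simps coeff_closed M.smult_l_distr Pi_iff)
  also have "\<dots> = evaluation m p \<oplus>\<^bsub>M\<^esub> evaluation m q"
    using p q m fin evaluation_superset[OF p mA fin] evaluation_superset[OF q mA fin]
    by (subst M.M.finsum_addf) (auto simp: coeff_closed Pi_iff)
  finally show ?thesis .
qed

text \<open>Both sides sum the terms \<open>q c\<close>, \<open>p d\<close>,
  \<open>m (c + d)\<close> over all pairs \<open>(c, d)\<close> from the two supports: the left side
  groups the pairs by \<open>c + d\<close>, the right side by \<open>c\<close>.\<close>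

lemma evaluation_mult:
  assumes p: "p \<in> carrier R" and q: "q \<in> carrier R" and m: "m \<in> UNIV \<rightarrow> carrier M"
  shows "evaluation m (q \<otimes>\<^bsub>R\<^esub> p) = evaluation (\<lambda>c. evaluation (\<lambda>d. m (c + d)) p) q"
proof -
  let ?A = "supp q \<times> supp p"
  let ?E = "(\<lambda>(c, d). c + d) ` ?A"
  define g where "g x = \<phi> (q (fst x) \<otimes>\<^bsub>K\<^esub> p (snd x)) \<odot>\<^bsub>M\<^esub> m (fst x + snd x)" for x
  note [simp] = coeff_closed[OF p] coeff_closed[OF q]
  have mc [simp]: "m e \<in> carrier M" for e using m by auto
  have g [simp]: "g x \<in> carrier M" for x by (simp add: g_def)
  have fin: "finite (supp q)" "finite (supp p)" using p q by (auto simp: carrier_R)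
  have "supp (q \<otimes>\<^bsub>R\<^esub> p) \<subseteq> ?E"
  proof
    fix e assume "e \<in> supp (q \<otimes>\<^bsub>R\<^esub> p)"
    then have "(\<Oplus>\<^bsub>K\<^esub>x\<in>decompositions e. q (fst x) \<otimes>\<^bsub>K\<^esub> p (snd x)) \<noteq> \<zero>\<^bsub>K\<^esub>"
      using p q by (simp add: mult_R)
    then obtain c d where "c + d = e" "q c \<otimes>\<^bsub>K\<^esub> p d \<noteq> \<zero>\<^bsub>K\<^esub>"
      by (auto elim!: finsum_nonzeroE simp: decompositions_def)
    then have "(c, d) \<in> ?A" by auto
    then show "e \<in> ?E" using \<open>c + d = e\<close> by (intro image_eqI[of _ _ "(c, d)"]) auto
  qed
  then have "evaluation m (q \<otimes>\<^bsub>R\<^esub> p) = (\<Oplus>\<^bsub>M\<^esub>e\<in>?E. \<phi> ((q \<otimes>\<^bsub>R\<^esub> p) e) \<odot>\<^bsub>M\<^esub> m e)"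
    using p q fin by (intro evaluation_superset) (auto simp: mult_closed_R)
  also have "\<dots> = (\<Oplus>\<^bsub>M\<^esub>e\<in>?E. finsum M g (decompositions e))"
  proof (intro M.M.finsum_cong' refl)
    fix e assume "e \<in> ?E"
    have "\<phi> ((q \<otimes>\<^bsub>R\<^esub> p) e) = (\<Oplus>\<^bsub>L\<^esub>x\<in>decompositions e. \<phi> (q (fst x) \<otimes>\<^bsub>K\<^esub> p (snd x)))"
      using p q by (simp add: mult_R split_beta \<phi>.hom_finsum Pi_def comp_def)
    also have "\<dots> \<odot>\<^bsub>M\<^esub> m e = (\<Oplus>\<^bsub>M\<^esub>x\<in>decompositions e. \<phi> (q (fst x) \<otimes>\<^bsub>K\<^esub> p (snd x)) \<odot>\<^bsub>M\<^esub> m e)"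
      by (rule M.finsum_smult_rdistr) auto
    also have "\<dots> = finsum M g (decompositions e)"
      by (intro M.M.finsum_cong') (auto simp: g_def decompositions_def)
    finally show "\<phi> ((q \<otimes>\<^bsub>R\<^esub> p) e) \<odot>\<^bsub>M\<^esub> m e = finsum M g (decompositions e)" .
  qed (auto intro!: M.M.finsum_closed)
  also have "\<dots> = finsum M g (\<Union>e\<in>?E. decompositions e)"
  proof (intro M.M.add.finprod_UN_disjoint[symmetric])
    have "i = j" if "x \<in> decompositions i" "x \<in> decompositions j" for i j and x :: "nat multiset \<times> nat multiset"
      using that by (auto simp: decompositions_def)
    then show "pairwise (\<lambda>i j. disjnt (decompositions i) (decompositions j)) ?E"
      unfolding pairwise_def disjnt_iff by blast
  qed (use fin in auto)
  \<comment> \<open>The pairs with an entry outside the supports contribute zero and are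
    dropped.\<close>
  also have "\<dots> = finsum M g ?A"
  proof (intro M.M.add.finprod_mono_neutral_cong_right)
    have "x \<in> decompositions (fst x + snd x)" "fst x + snd x \<in> ?E" if "x \<in> ?A" for x
      using that by (auto simp: decompositions_def intro!: image_eqI[of _ _ x])
    then show "?A \<subseteq> (\<Union>e\<in>?E. decompositions e)" by blast
    fix x assume "x \<in> (\<Union>e\<in>?E. decompositions e) - ?A"
    then have "q (fst x) \<otimes>\<^bsub>K\<^esub> p (snd x) = \<zero>\<^bsub>K\<^esub>" by (cases x) auto
    then show "g x = \<zero>\<^bsub>M\<^esub>" by (simp add: g_def)
  qed (use fin in auto)
  also have "\<dots> = (\<Oplus>\<^bsub>M\<^esub>c\<in>supp q. \<Oplus>\<^bsub>M\<^esub>d\<in>supp p. g (c, d))"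
    using fin by (intro M.M.finsum_Sigma) auto
  also have "\<dots> = evaluation (\<lambda>c. evaluation (\<lambda>d. m (c + d)) p) q"
    unfolding evaluation_def using fin
    by (intro M.M.finsum_cong' refl) (auto simp: g_def M.finsum_smult_ldistr M.smult_assoc1 intro!: M.M.finsum_closed)
  finally show ?thesis .
qed

end

section \<open>Multilinear extension\<close>

text \<open>An operator on maps rather than a mere existence statement, since the recursion for
  several arguments iterates it and depends on how the result varies with \<open>h\<close>.\<close>

definition linear_extension ::
    "'k ring \<Rightarrow> ('k, 'l) module \<Rightarrow> ('k, 'v) module \<Rightarrow> ('l, 'm, 'e) module_scheme \<Rightarrow> ('v \<Rightarrow> 'm) \<Rightarrow>
      ('l \<times> 'v \<Rightarrow>\<^sub>0 int) set \<Rightarrow> 'm" where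
  "linear_extension K L V M h =
     (THE g. g \<in> linear_maps L (base_change K L V) M \<and>
        (\<forall>v\<in>carrier V. g (pure_tensor K L V \<one>\<^bsub>L\<^esub> v) = h v))"

text \<open>These are the \<open>K\<close>-linear maps into \<open>M\<close> with scalars restricted
  along the structure map of \<open>L\<close>. In contrast to \<open>linear_maps\<close>, values off
  the carrier are free, because the maps arise by varying one argument of a function.\<close>

definition semilinear_maps ::
    "'k ring \<Rightarrow> ('k, 'l) module \<Rightarrow> ('k, 'v) module \<Rightarrow> ('l, 'm, 'e) module_scheme \<Rightarrow> ('v \<Rightarrow> 'm) set" where
  "semilinear_maps K L V M = {h \<in> carrier V \<rightarrow> carrier M.
     (\<forall>x\<in>carrier V. \<forall>y\<in>carrier V. h (x \<oplus>\<^bsub>V\<^esub> y) = h x \<oplus>\<^bsub>M\<^esub> h y) \<and>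
     (\<forall>k\<in>carrier K. \<forall>x\<in>carrier V. h (k \<odot>\<^bsub>V\<^esub> x) = (k \<odot>\<^bsub>L\<^esub> \<one>\<^bsub>L\<^esub>) \<odot>\<^bsub>M\<^esub> h x)}"

lemma linear_extension_cong:
  "(\<And>v. v \<in> carrier V \<Longrightarrow> h v = h' v) \<Longrightarrow> linear_extension K L V M h = linear_extension K L V M h'"
  unfolding linear_extension_def by (intro arg_cong[of _ _ The]) auto

context scalar_extension
begin

lemma linear_extension:
  assumes M: "module L M" and h: "h \<in> semilinear_maps K L V M"
  shows "linear_extension K L V M h \<in> linear_maps L B M"
    and "v \<in> carrier V \<Longrightarrow> linear_extension K L V M h (pure \<one>\<^bsub>L\<^esub> v) = h v"
proof -
  have "\<exists>!g. g \<in> linear_maps L B M \<and> (\<forall>v\<in>carrier V. g (pure \<one>\<^bsub>L\<^esub> v) = h v)"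
  proof (rule ex_ex1I)
    show "\<exists>g. g \<in> linear_maps L B M \<and> (\<forall>v\<in>carrier V. g (pure \<one>\<^bsub>L\<^esub> v) = h v)"
      by (rule linear_map_exists[OF M, of h]) (use h in \<open>auto simp: semilinear_maps_def\<close>)
  qed (auto intro: linear_map_eqI[OF M])
  from theI'[OF this]
  show "linear_extension K L V M h \<in> linear_maps L B M"
    and "v \<in> carrier V \<Longrightarrow> linear_extension K L V M h (pure \<one>\<^bsub>L\<^esub> v) = h v"
    unfolding linear_extension_def by auto
qed

lemma linear_extension_unique:
  assumes M: "module L M" and h: "h \<in> semilinear_maps K L V M"
    and g: "g \<in> linear_maps L B M" "\<And>v. v \<in> carrier V \<Longrightarrow> g (pure \<one>\<^bsub>L\<^esub> v) = h v"
  shows "linear_extension K L V M h = g"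
  using linear_extension[OF M h] g by (intro linear_map_eqI[OF M]) auto

text \<open>The pointwise sum of the two extensions is \<open>L\<close>-linear and has the right
  values at \<open>1 \<otimes> v\<close>, so uniqueness applies. This keeps additivity in the other
  arguments intact while one argument is extended; the next lemma does the same for scalars.\<close>

lemma linear_extension_add:
  assumes M: "module L M" and h: "h \<in> semilinear_maps K L V M" "h1 \<in> semilinear_maps K L V M"
      "h2 \<in> semilinear_maps K L V M"
    and eq: "\<And>v. v \<in> carrier V \<Longrightarrow> h v = h1 v \<oplus>\<^bsub>M\<^esub> h2 v" and y: "y \<in> carrier B"
  shows "linear_extension K L V M h y =
    linear_extension K L V M h1 y \<oplus>\<^bsub>M\<^esub> linear_extension K L V M h2 y"
proof -
  interpret M: module L M by fact
  interpret BM: module L B by (rule B_module)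
  let ?g = "\<lambda>y\<in>carrier B. linear_extension K L V M h1 y \<oplus>\<^bsub>M\<^esub> linear_extension K L V M h2 y"
  have lin: "linear_extension K L V M h1 \<in> linear_maps L B M" "linear_extension K L V M h2 \<in> linear_maps L B M"
    using linear_extension(1)[OF M] h by auto
  have cl: "linear_extension K L V M h1 y \<in> carrier M" "linear_extension K L V M h2 y \<in> carrier M"
    if "y \<in> carrier B" for y
    using lin that by (auto simp: linear_maps_def)
  have "linear_extension K L V M h = ?g"
  proof (rule linear_extension_unique[OF M h(1)])
    show "?g \<in> linear_maps L B M"
      using lin by (auto simp: linear_maps_def cl M.smult_r_distr M.M.a_ac)
    fix v assume "v \<in> carrier V"
    then show "?g (pure \<one>\<^bsub>L\<^esub> v) = h v"
      using linear_extension(2)[OF M] h eq by simp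
  qed
  then show ?thesis using y by simp
qed

lemma linear_extension_smult:
  assumes M: "module L M" and h: "h \<in> semilinear_maps K L V M" "h1 \<in> semilinear_maps K L V M"
    and l: "l \<in> carrier L" and eq: "\<And>v. v \<in> carrier V \<Longrightarrow> h v = l \<odot>\<^bsub>M\<^esub> h1 v" and y: "y \<in> carrier B"
  shows "linear_extension K L V M h y = l \<odot>\<^bsub>M\<^esub> linear_extension K L V M h1 y"
proof -
  interpret M: module L M by fact
  interpret BM: module L B by (rule B_module)
  let ?g = "\<lambda>y\<in>carrier B. l \<odot>\<^bsub>M\<^esub> linear_extension K L V M h1 y"
  have lin: "linear_extension K L V M h1 \<in> linear_maps L B M"
    using linear_extension(1)[OF M] h by auto
  have cl: "linear_extension K L V M h1 y \<in> carrier M" if "y \<in> carrier B" for y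
    using lin that by (auto simp: linear_maps_def)
  have "linear_extension K L V M h = ?g"
  proof (rule linear_extension_unique[OF M h(1)])
    \<comment> \<open>Multiplication by \<open>l\<close> is itself \<open>L\<close>-linear because
      \<open>L\<close> is commutative.\<close>
    have "l \<odot>\<^bsub>M\<^esub> (r \<odot>\<^bsub>M\<^esub> x) = r \<odot>\<^bsub>M\<^esub> (l \<odot>\<^bsub>M\<^esub> x)" if "r \<in> carrier L" "x \<in> carrier M" for r x
      using that l by (metis M.smult_assoc1 alg.m_comm)
    then show "?g \<in> linear_maps L B M"
      using lin l by (auto simp: linear_maps_def cl M.smult_r_distr)
    fix v assume "v \<in> carrier V"
    then show "?g (pure \<one>\<^bsub>L\<^esub> v) = h v"
      using linear_extension(2)[OF M] h eq by simp
  qed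
  then show ?thesis using y by simp
qed

end

lemma args_upd: "v \<in> args n V \<Longrightarrow> a \<in> {1..n} \<Longrightarrow> x \<in> carrier (V a) \<Longrightarrow> v(a := x) \<in> args n V"
  by (auto simp: args_def PiE_iff extensional_def)

lemma args_closed: "v \<in> args n V \<Longrightarrow> a \<in> {1..n} \<Longrightarrow> v a \<in> carrier (V a)"
  by (auto simp: args_def)

lemma args_restrict: "v \<in> args n V \<Longrightarrow> (\<lambda>a\<in>{1..n}. v a) = v"
  by (auto simp: args_def)

lemma multilinear_mapsD:
  assumes "f \<in> multilinear_maps R n V" "v \<in> args n V"
  shows "f v \<in> carrier (V 0)"
    and "a \<in> {1..n} \<Longrightarrow> (\<lambda>x\<in>carrier (V a). f (v(a := x))) \<in> linear_maps R (V a) (V 0)"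
  using assms by (auto simp: multilinear_maps_def)

text \<open>In \<open>partial_extension K V L f k v w\<close> the first \<open>k\<close> arguments are read off \<open>w\<close>, the others off \<open>v\<close>.\<close>

primrec partial_extension ::
    "'k ring \<Rightarrow> (nat \<Rightarrow> ('k, 'v) module) \<Rightarrow> ('k, 'l) module \<Rightarrow> ((nat \<Rightarrow> 'v) \<Rightarrow> 'v) \<Rightarrow> nat \<Rightarrow>
      (nat \<Rightarrow> 'v) \<Rightarrow> (nat \<Rightarrow> ('l \<times> 'v \<Rightarrow>\<^sub>0 int) set) \<Rightarrow> ('l \<times> 'v \<Rightarrow>\<^sub>0 int) set" where
  "partial_extension K V L f 0 = (\<lambda>v w. pure_tensor K L (V 0) \<one>\<^bsub>L\<^esub> (f v))"
| "partial_extension K V L f (Suc k) = (\<lambda>v w.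
     linear_extension K L (V (Suc k)) (base_change K L (V 0))
       (\<lambda>x. partial_extension K V L f k (v(Suc k := x)) w) (w (Suc k)))"

section \<open>Extension of a multilinear map along the frame\<close>

locale frame_extension = alg: algebra K L
  for K :: "'k ring" and L :: "('k, 'l) module" +
  fixes n :: nat and V :: "nat \<Rightarrow> ('k, 'v) module"
  assumes frame_module: "a \<le> n \<Longrightarrow> module K (V a)"
begin

abbreviation BV where "BV \<equiv> base_change_frame K L V"
abbreviation pt where "pt a \<equiv> pure_tensor K L (V a)"
abbreviation PE where "PE \<equiv> partial_extension K V L"

lemma scalar_extension: "a \<le> n \<Longrightarrow> scalar_extension K L (V a)"
  using frame_module alg.algebra_axioms by (simp add: scalar_extension_def)

lemmas BV_module = scalar_extension.B_module[OF scalar_extension]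

lemma pt_closed: "a \<le> n \<Longrightarrow> l \<in> carrier L \<Longrightarrow> v \<in> carrier (V a) \<Longrightarrow> pt a l v \<in> carrier (BV a)"
  by (rule scalar_extension.pure_closed[OF scalar_extension])

text \<open>Agreement spreads from the arguments \<open>1 \<otimes> v\<close> to all arguments one
  position at a time, since a linear map in a single argument is determined by its values on such
  elements.\<close>

lemma multilinear_maps_eqI:
  assumes g: "g \<in> multilinear_maps L n BV" and g': "g' \<in> multilinear_maps L n BV"
    and eq: "\<And>v. v \<in> args n V \<Longrightarrow>
      g (\<lambda>a\<in>{1..n}. pt a \<one>\<^bsub>L\<^esub> (v a)) = g' (\<lambda>a\<in>{1..n}. pt a \<one>\<^bsub>L\<^esub> (v a))"
  shows "g = g'"
proof -
  \<comment> \<open>The first \<open>k\<close> entries of \<open>w\<close> are arbitrary and the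
    later ones are of the form \<open>1 \<otimes> v\<close>; the induction frees one more entry in
    each step.\<close>
  have main: "g w = g' w"
    if "k \<le> n" "w \<in> args n BV" "\<And>a. a \<in> {k<..n} \<Longrightarrow> w a \<in> pt a \<one>\<^bsub>L\<^esub> ` carrier (V a)" for k w
    using that
  proof (induction k arbitrary: w)
    case 0
    have "\<forall>a\<in>{1..n}. \<exists>x. x \<in> carrier (V a) \<and> w a = pt a \<one>\<^bsub>L\<^esub> x"
    proof
      fix a assume "a \<in> {1..n}"
      then have "w a \<in> pt a \<one>\<^bsub>L\<^esub> ` carrier (V a)" by (intro 0(3)) simp
      then show "\<exists>x. x \<in> carrier (V a) \<and> w a = pt a \<one>\<^bsub>L\<^esub> x" by blast
    qed
    from bchoice[OF this]
    obtain u where u: "\<And>a. a \<in> {1..n} \<Longrightarrow> u a \<in> carrier (V a) \<and> w a = pt a \<one>\<^bsub>L\<^esub> (u a)"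
      by blast
    then have ru: "restrict u {1..n} \<in> args n V" by (auto simp: args_def)
    have wu: "w = (\<lambda>a\<in>{1..n}. pt a \<one>\<^bsub>L\<^esub> (restrict u {1..n} a))"
      by (subst args_restrict[OF 0(2), symmetric], intro restrict_ext) (use u in simp)
    show ?case using eq[OF ru] unfolding wu[symmetric] .
  next
    case (Suc k)
    let ?a = "Suc k"
    have a: "?a \<in> {1..n}" using Suc by simp
    have "(\<lambda>x\<in>carrier (BV ?a). g (w(?a := x))) = (\<lambda>x\<in>carrier (BV ?a). g' (w(?a := x)))"
    proof (rule scalar_extension.linear_map_eqI[OF scalar_extension BV_module[of 0]])
      fix v assume v: "v \<in> carrier (V ?a)"
      then have pt: "pt ?a \<one>\<^bsub>L\<^esub> v \<in> carrier (BV ?a)" using a by (intro pt_closed) auto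
      moreover have "g (w(?a := pt ?a \<one>\<^bsub>L\<^esub> v)) = g' (w(?a := pt ?a \<one>\<^bsub>L\<^esub> v))"
        using Suc.prems v pt a by (intro Suc.IH args_upd) auto
      ultimately show "(\<lambda>x\<in>carrier (BV ?a). g (w(?a := x))) (pt ?a \<one>\<^bsub>L\<^esub> v) =
          (\<lambda>x\<in>carrier (BV ?a). g' (w(?a := x))) (pt ?a \<one>\<^bsub>L\<^esub> v)" by simp
    qed (use a multilinear_mapsD(2)[OF g Suc.prems(2)] multilinear_mapsD(2)[OF g' Suc.prems(2)] in auto)
    then have "(\<lambda>x\<in>carrier (BV ?a). g (w(?a := x))) (w ?a) = (\<lambda>x\<in>carrier (BV ?a). g' (w(?a := x))) (w ?a)"
      by simp
    then show ?case using args_closed[OF Suc.prems(2) a] by simp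
  qed
  show ?thesis
  proof (rule extensionalityI[of _ "args n BV"])
    show "g \<in> extensional (args n BV)" "g' \<in> extensional (args n BV)"
      using g g' by (simp_all add: multilinear_maps_def PiE_def)
  \<comment> \<open>For \<open>k = n\<close> the range \<open>{k<..n}\<close> is empty, so every
    \<open>w\<close> is covered.\<close>
  qed (use main[of n] in auto)
qed

text \<open>The invariant of the recursion on \<open>k\<close>. Semilinearity in the arguments after
  \<open>k\<close> allows the next one to be extended. Independence of the later entries of
  \<open>w\<close> ensures that the new entry only enters as the point at which the extension is
  evaluated.\<close>

definition extends_first :: "((nat \<Rightarrow> 'v) \<Rightarrow> 'v) \<Rightarrow> nat \<Rightarrow> bool" where
  "extends_first f k \<longleftrightarrow> (\<forall>v\<in>args n V. \<forall>w\<in>args n BV.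
     PE f k v w \<in> carrier (BV 0) \<and>
     (\<forall>a\<in>{k<..n}. (\<lambda>x. PE f k (v(a := x)) w) \<in> semilinear_maps K L (V a) (BV 0)) \<and>
     (\<forall>a\<in>{k<..n}. \<forall>y\<in>carrier (BV a). PE f k v (w(a := y)) = PE f k v w) \<and>
     (\<forall>a\<in>{1..k}. (\<lambda>y\<in>carrier (BV a). PE f k v (w(a := y))) \<in> linear_maps L (BV a) (BV 0)) \<and>
     (\<forall>u\<in>args n V. PE f k v (\<lambda>a\<in>{1..n}. pt a \<one>\<^bsub>L\<^esub> (u a)) =
        pt 0 \<one>\<^bsub>L\<^esub> (f (\<lambda>a\<in>{1..n}. if a \<le> k then u a else v a))))"

lemma extends_firstD:
  assumes "extends_first f k" "v \<in> args n V" "w \<in> args n BV"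
  shows "PE f k v w \<in> carrier (BV 0)"
    and "a \<in> {k<..n} \<Longrightarrow> (\<lambda>x. PE f k (v(a := x)) w) \<in> semilinear_maps K L (V a) (BV 0)"
    and "a \<in> {k<..n} \<Longrightarrow> y \<in> carrier (BV a) \<Longrightarrow> PE f k v (w(a := y)) = PE f k v w"
    and "a \<in> {1..k} \<Longrightarrow> (\<lambda>y\<in>carrier (BV a). PE f k v (w(a := y))) \<in> linear_maps L (BV a) (BV 0)"
    and "u \<in> args n V \<Longrightarrow>
      PE f k v (\<lambda>a\<in>{1..n}. pt a \<one>\<^bsub>L\<^esub> (u a)) = pt 0 \<one>\<^bsub>L\<^esub> (f (\<lambda>a\<in>{1..n}. if a \<le> k then u a else v a))"
  using assms unfolding extends_first_def by blast+

lemma extends_first_0: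
  assumes f: "f \<in> multilinear_maps K n V"
  shows "extends_first f 0"
  unfolding extends_first_def
proof (intro ballI conjI)
  interpret V0: scalar_extension K L "V 0" by (rule scalar_extension) simp
  fix v w assume v: "v \<in> args n V" and w: "w \<in> args n BV"
  show "PE f 0 v w \<in> carrier (BV 0)"
    using multilinear_mapsD(1)[OF f v] by (auto intro!: pt_closed)
  show "PE f 0 v (\<lambda>a\<in>{1..n}. pt a \<one>\<^bsub>L\<^esub> (u a)) =
      pt 0 \<one>\<^bsub>L\<^esub> (f (\<lambda>a\<in>{1..n}. if a \<le> 0 then u a else v a))" for u
    using args_restrict[OF v] by (simp cong: restrict_cong)
  fix a assume "a \<in> {0<..n}"
  then have a: "a \<in> {1..n}" by auto
  interpret Va: module K "V a" using frame_module a by simp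
  have h: "(\<lambda>x\<in>carrier (V a). f (v(a := x))) \<in> linear_maps K (V a) (V 0)"
    using multilinear_mapsD(2)[OF f v a] .
  have cl: "f (v(a := x)) \<in> carrier (V 0)" if "x \<in> carrier (V a)" for x
    using multilinear_mapsD(1)[OF f] args_upd[OF v a that] by simp
  have "f (v(a := x \<oplus>\<^bsub>V a\<^esub> y)) = f (v(a := x)) \<oplus>\<^bsub>V 0\<^esub> f (v(a := y))"
    if "x \<in> carrier (V a)" "y \<in> carrier (V a)" for x y
    using h that by (auto simp: linear_maps_def)
  moreover have "f (v(a := k \<odot>\<^bsub>V a\<^esub> x)) = k \<odot>\<^bsub>V 0\<^esub> f (v(a := x))"
    if "k \<in> carrier K" "x \<in> carrier (V a)" for k x
    using h that by (auto simp: linear_maps_def)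
  \<comment> \<open>Composition with \<open>x \<mapsto> 1 \<otimes> x\<close> makes \<open>f\<close>
    semilinear: the scalar crosses to the left factor, where it acts as an element of
    \<open>L\<close>.\<close>
  moreover have "pt 0 \<one>\<^bsub>L\<^esub> (k \<odot>\<^bsub>V 0\<^esub> x) = (k \<odot>\<^bsub>L\<^esub> \<one>\<^bsub>L\<^esub>) \<odot>\<^bsub>BV 0\<^esub> pt 0 \<one>\<^bsub>L\<^esub> x"
    if "k \<in> carrier K" "x \<in> carrier (V 0)" for k x
    using that by (simp add: V0.pure_smult[symmetric] V0.smult_pure)
  ultimately show "(\<lambda>x. PE f 0 (v(a := x)) w) \<in> semilinear_maps K L (V a) (BV 0)"
    unfolding semilinear_maps_def partial_extension.simps using cl
    by (intro CollectI conjI ballI funcsetI) (simp_all only: V0.pure_closed V0.pure_add_right alg.one_closed)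
qed simp_all

text \<open>Linearity in argument \<open>Suc k\<close> is built into the linear extension. In every
  other argument it is inherited, because \<open>linear_extension\<close> depends additively and
  homogeneously on the map that is extended.\<close>

lemma extends_first_Suc:
  assumes b: "Suc k \<le> n" and IH: "extends_first f k"
  shows "extends_first f (Suc k)"
proof -
  let ?b = "Suc k"
  have b: "?b \<in> {1..n}" "?b \<in> {k<..n}" "?b \<le> n" using b by auto
  interpret Vb: scalar_extension K L "V ?b" by (rule scalar_extension) (rule b)
  interpret M: module L "BV 0" by (rule BV_module) simp
  let ?h = "\<lambda>v w x. PE f k (v(?b := x)) w"
  have h: "?h v w \<in> semilinear_maps K L (V ?b) (BV 0)" if "v \<in> args n V" "w \<in> args n BV" for v w
    using extends_firstD(2)[OF IH that b(2)] .
  have ext: "linear_extension K L (V ?b) (BV 0) (?h v w) \<in> linear_maps L (BV ?b) (BV 0)"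
    if "v \<in> args n V" "w \<in> args n BV" for v w
    by (rule Vb.linear_extension[OF M.module_axioms h[OF that]])
  have closed: "PE f ?b v w \<in> carrier (BV 0)" if "v \<in> args n V" "w \<in> args n BV" for v w
    using ext[OF that] args_closed[OF that(2) b(1)] by (auto simp: linear_maps_def)
  show ?thesis
    unfolding extends_first_def
  proof (intro ballI conjI)
    fix v w assume v: "v \<in> args n V" and w: "w \<in> args n BV"
    show "PE f ?b v w \<in> carrier (BV 0)" using closed[OF v w] .
    fix a assume "a \<in> {?b<..n}"
    then have a: "a \<in> {1..n}" "a \<in> {k<..n}" "a \<noteq> ?b" "a \<le> n" by auto
    interpret Va: module K "V a" using frame_module a by simp
    have wb: "w ?b \<in> carrier (BV ?b)" using args_closed[OF w b(1)] .
    \<comment> \<open>Updates at the distinct positions \<open>a\<close> and \<open>?b\<close>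
      commute, so the hypothesis for argument \<open>a\<close> is available at each value
      \<open>z\<close> of argument \<open>?b\<close>.\<close>
    have lin: "(\<lambda>x. PE f k (v(?b := z, a := x)) w) \<in> semilinear_maps K L (V a) (BV 0)"
      if "z \<in> carrier (V ?b)" for z
      by (rule extends_firstD(2)[OF IH args_upd[where V = V, OF v b(1) that] w a(2)])
    have h': "?h (v(a := x)) w \<in> semilinear_maps K L (V ?b) (BV 0)" if "x \<in> carrier (V a)" for x
      by (rule h[OF args_upd[where V = V, OF v a(1) that] w])
    show "(\<lambda>x. PE f ?b (v(a := x)) w) \<in> semilinear_maps K L (V a) (BV 0)"
      unfolding semilinear_maps_def
    proof (intro CollectI conjI ballI funcsetI)
      fix x assume x: "x \<in> carrier (V a)"
      then show "PE f ?b (v(a := x)) w \<in> carrier (BV 0)"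
        by (intro closed args_upd v w a)
      fix y assume y: "y \<in> carrier (V a)"
      show "PE f ?b (v(a := x \<oplus>\<^bsub>V a\<^esub> y)) w = PE f ?b (v(a := x)) w \<oplus>\<^bsub>BV 0\<^esub> PE f ?b (v(a := y)) w"
        unfolding partial_extension.simps
        using lin x y a(3) by (intro Vb.linear_extension_add[OF M.module_axioms] h' wb)
          (auto simp: semilinear_maps_def fun_upd_twist[of a])
    next
      fix r x assume r: "r \<in> carrier K" and x: "x \<in> carrier (V a)"
      show "PE f ?b (v(a := r \<odot>\<^bsub>V a\<^esub> x)) w = (r \<odot>\<^bsub>L\<^esub> \<one>\<^bsub>L\<^esub>) \<odot>\<^bsub>BV 0\<^esub> PE f ?b (v(a := x)) w"
        unfolding partial_extension.simps
        using lin x r a(3) by (intro Vb.linear_extension_smult[OF M.module_axioms] h' wb)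
          (auto simp: semilinear_maps_def fun_upd_twist[of a])
    qed
    show "PE f ?b v (w(a := y)) = PE f ?b v w" if y: "y \<in> carrier (BV a)" for y
      using extends_firstD(3)[OF IH args_upd[where V = V, OF v b(1)] w a(2) y] a(3)
      by (auto intro!: fun_cong[OF linear_extension_cong])
  next
    fix v w a assume v: "v \<in> args n V" and w: "w \<in> args n BV" and a4: "a \<in> {1..?b}"
    then have a: "a \<in> {1..n}" "a \<le> n" using b by auto
    interpret Ba: module L "BV a" using BV_module a by simp
    show "(\<lambda>y\<in>carrier (BV a). PE f ?b v (w(a := y))) \<in> linear_maps L (BV a) (BV 0)"
    proof (cases "a = ?b")
      case True
      \<comment> \<open>The map being extended ignores entry \<open>?b\<close> of \<open>w\<close>;
        varying that entry moves only the point of evaluation.\<close>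
      have "(\<lambda>y\<in>carrier (BV a). PE f ?b v (w(a := y))) =
          (\<lambda>y\<in>carrier (BV ?b). linear_extension K L (V ?b) (BV 0) (?h v w) y)"
        using extends_firstD(3)[OF IH args_upd[where V = V, OF v b(1)] w b(2) _] True
        by (auto intro!: restrict_ext fun_cong[OF linear_extension_cong])
      also have "\<dots> = linear_extension K L (V ?b) (BV 0) (?h v w)"
        using ext[OF v w] by (auto simp: linear_maps_def)
      finally show ?thesis using ext[OF v w] True by simp
    next
      case False
      then have a': "a \<in> {1..k}" "a \<noteq> ?b" using a4 by auto
      have wb: "w ?b \<in> carrier (BV ?b)" using args_closed[OF w b(1)] .
      have lin: "(\<lambda>y\<in>carrier (BV a). PE f k (v(?b := z)) (w(a := y))) \<in> linear_maps L (BV a) (BV 0)"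
        if "z \<in> carrier (V ?b)" for z
        by (rule extends_firstD(4)[OF IH args_upd[where V = V, OF v b(1) that] w a'(1)])
      have h': "?h v (w(a := y)) \<in> semilinear_maps K L (V ?b) (BV 0)" if "y \<in> carrier (BV a)" for y
        by (rule h[OF v args_upd[where V = BV, OF w a(1) that]])
      have "PE f ?b v (w(a := x \<oplus>\<^bsub>BV a\<^esub> y)) = PE f ?b v (w(a := x)) \<oplus>\<^bsub>BV 0\<^esub> PE f ?b v (w(a := y))"
        if "x \<in> carrier (BV a)" "y \<in> carrier (BV a)" for x y
        using that lin wb a'(2) unfolding partial_extension.simps fun_upd_other[OF a'(2)[symmetric]]
        by (intro Vb.linear_extension_add[OF M.module_axioms] h' wb)
          (auto simp: linear_maps_def)
      moreover have "PE f ?b v (w(a := l \<odot>\<^bsub>BV a\<^esub> x)) = l \<odot>\<^bsub>BV 0\<^esub> PE f ?b v (w(a := x))"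
        if "l \<in> carrier L" "x \<in> carrier (BV a)" for l x
        using that lin wb a'(2) unfolding partial_extension.simps fun_upd_other[OF a'(2)[symmetric]]
        by (intro Vb.linear_extension_smult[OF M.module_axioms] h' wb)
          (auto simp: linear_maps_def)
      moreover have "PE f ?b v (w(a := x)) \<in> carrier (BV 0)" if "x \<in> carrier (BV a)" for x
        by (intro closed v w args_upd[where V = BV] a that)
      ultimately show ?thesis
        by (auto simp: linear_maps_def simp del: partial_extension.simps)
    qed
  next
    fix v u assume v: "v \<in> args n V" and u: "u \<in> args n V"
    let ?w = "\<lambda>a\<in>{1..n}. pt a \<one>\<^bsub>L\<^esub> (u a)"
    have w: "?w \<in> args n BV" using u by (auto simp: args_def intro!: pt_closed)
    have ub: "u ?b \<in> carrier (V ?b)" using args_closed[OF u b(1)] .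
    \<comment> \<open>At \<open>1 \<otimes> u ?b\<close> the extension returns the map it extends,
      which transfers the entry \<open>u ?b\<close> into \<open>v\<close>.\<close>
    have "PE f ?b v ?w = PE f k (v(?b := u ?b)) ?w"
      using Vb.linear_extension(2)[OF M.module_axioms h[OF v w] ub] b by simp
    also have "\<dots> = pt 0 \<one>\<^bsub>L\<^esub> (f (\<lambda>a\<in>{1..n}. if a \<le> k then u a else (v(?b := u ?b)) a))"
      by (rule extends_firstD(5)[OF IH args_upd[where V = V, OF v b(1) ub] w u])
    also have "(\<lambda>a\<in>{1..n}. if a \<le> k then u a else (v(?b := u ?b)) a) =
        (\<lambda>a\<in>{1..n}. if a \<le> ?b then u a else v a)"
      by (auto simp: le_Suc_eq)
    finally show "PE f ?b v ?w = pt 0 \<one>\<^bsub>L\<^esub> (f (\<lambda>a\<in>{1..n}. if a \<le> ?b then u a else v a))" .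
  qed
qed

lemma extends_first:
  assumes "f \<in> multilinear_maps K n V" "k \<le> n"
  shows "extends_first f k"
  using assms(2) by (induction k) (simp_all add: extends_first_0[OF assms(1)] extends_first_Suc)

text \<open>Justifies the definite description: \<open>PE\<close> with all \<open>n\<close>
  arguments extended gives existence, and \<open>multilinear_maps_eqI\<close> gives
  uniqueness.\<close>

lemma multilinear_extension_in:
  assumes f: "f \<in> multilinear_maps K n V"
  shows "multilinear_extension K n V L f \<in> multilinear_maps L n BV"
proof -
  let ?P = "\<lambda>g. g \<in> multilinear_maps L n BV \<and>
        (\<forall>v\<in>args n V. g (\<lambda>a\<in>{1..n}. pt a \<one>\<^bsub>L\<^esub> (v a)) = pt 0 \<one>\<^bsub>L\<^esub> (f v))"
  \<comment> \<open>With \<open>k = n\<close> every argument is taken from \<open>w\<close>, so any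
    base point serves; the zero tuple is one that exists.\<close>
  define v0 where "v0 = (\<lambda>a\<in>{1..n}. \<zero>\<^bsub>V a\<^esub>)"
  have v0: "v0 \<in> args n V"
    using frame_module unfolding v0_def args_def
    by (auto simp: module_def abelian_group_def intro!: abelian_monoid.zero_closed)
  define g where "g = (\<lambda>w\<in>args n BV. PE f n v0 w)"
  have "\<exists>!g. ?P g"
  proof (rule ex_ex1I)
    have "g \<in> multilinear_maps L n BV"
      unfolding multilinear_maps_def
    proof (intro CollectI conjI ballI)
      show "g \<in> args n BV \<rightarrow>\<^sub>E carrier (BV 0)"
        using extends_firstD(1)[OF extends_first[OF f order_refl] v0] by (auto simp: g_def)
      fix w a assume w: "w \<in> args n BV" and a: "a \<in> {1..n}"
      have "(\<lambda>x\<in>carrier (BV a). g (w(a := x))) = (\<lambda>x\<in>carrier (BV a). PE f n v0 (w(a := x)))"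
        using args_upd[where V = BV, OF w a] by (intro restrict_ext) (simp add: g_def)
      then show "(\<lambda>x\<in>carrier (BV a). g (w(a := x))) \<in> linear_maps L (BV a) (BV 0)"
        using extends_firstD(4)[OF extends_first[OF f order_refl] v0 w a] by simp
    qed
    moreover have "g (\<lambda>a\<in>{1..n}. pt a \<one>\<^bsub>L\<^esub> (v a)) = pt 0 \<one>\<^bsub>L\<^esub> (f v)" if v: "v \<in> args n V" for v
    proof -
      have "(\<lambda>a\<in>{1..n}. pt a \<one>\<^bsub>L\<^esub> (v a)) \<in> args n BV"
        using v by (auto simp: args_def intro!: pt_closed)
      then show ?thesis
        using extends_firstD(5)[OF extends_first[OF f order_refl] v0 _ v] args_restrict[OF v]
        by (simp add: g_def cong: restrict_cong)
    qed
    ultimately show "\<exists>g. ?P g" by blast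
  qed (auto intro!: multilinear_maps_eqI)
  from theI'[OF this] show ?thesis
    unfolding multilinear_extension_def by blast
qed

end

section \<open>Operators annihilated by linear forms\<close>

lemma linear_mapsD:
  assumes "f \<in> linear_maps R M N"
  shows "x \<in> carrier M \<Longrightarrow> f x \<in> carrier N"
    and "x \<in> carrier M \<Longrightarrow> y \<in> carrier M \<Longrightarrow> f (x \<oplus>\<^bsub>M\<^esub> y) = f x \<oplus>\<^bsub>N\<^esub> f y"
    and "r \<in> carrier R \<Longrightarrow> x \<in> carrier M \<Longrightarrow> f (r \<odot>\<^bsub>M\<^esub> x) = r \<odot>\<^bsub>N\<^esub> f x"
  using assms by (auto simp: linear_maps_def)

context polynomial_evaluation
begin

text \<open>Powers of a linear map pass through the sum that defines \<open>evaluation\<close>.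
  Their linearity is stated on the carrier instead of through \<open>linear_maps\<close>, as a power
  need not be extensional, already for \<open>j = 0\<close>.\<close>

lemma evaluation_commutes_funpow:
  assumes T: "T \<in> linear_maps L M M" and p: "p \<in> carrier R" and m: "m \<in> UNIV \<rightarrow> carrier M"
  shows "evaluation (\<lambda>e. (T ^^ j) (m e)) p = (T ^^ j) (evaluation m p)"
proof -
  note [simp] = coeff_closed[OF p]
  have mc [simp]: "m e \<in> carrier M" for e using m by auto
  have cl [simp]: "(T ^^ j) x \<in> carrier M" if "x \<in> carrier M" for x
    using that linear_mapsD(1)[OF T] by (induction j) auto
  have add: "(T ^^ j) (x \<oplus>\<^bsub>M\<^esub> y) = (T ^^ j) x \<oplus>\<^bsub>M\<^esub> (T ^^ j) y"
    if "x \<in> carrier M" "y \<in> carrier M" for x y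
  proof -
    have "(T ^^ j) x \<in> carrier M \<and> (T ^^ j) y \<in> carrier M \<and>
        (T ^^ j) (x \<oplus>\<^bsub>M\<^esub> y) = (T ^^ j) x \<oplus>\<^bsub>M\<^esub> (T ^^ j) y"
      using that linear_mapsD(1,2)[OF T] by (induction j) auto
    then show ?thesis by blast
  qed
  have smult: "(T ^^ j) (l \<odot>\<^bsub>M\<^esub> x) = l \<odot>\<^bsub>M\<^esub> (T ^^ j) x" if "l \<in> carrier L" "x \<in> carrier M" for l x
  proof -
    have "(T ^^ j) x \<in> carrier M \<and> (T ^^ j) (l \<odot>\<^bsub>M\<^esub> x) = l \<odot>\<^bsub>M\<^esub> (T ^^ j) x"
      using that linear_mapsD(1,3)[OF T] by (induction j) auto
    then show ?thesis by blast
  qed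
  have zero: "(T ^^ j) \<zero>\<^bsub>M\<^esub> = \<zero>\<^bsub>M\<^esub>"
    using smult[of "\<zero>\<^bsub>L\<^esub>" "\<zero>\<^bsub>M\<^esub>"] by simp
  have "finite A \<Longrightarrow> (\<Oplus>\<^bsub>M\<^esub>e\<in>A. \<phi> (p e) \<odot>\<^bsub>M\<^esub> (T ^^ j) (m e)) =
      (T ^^ j) (\<Oplus>\<^bsub>M\<^esub>e\<in>A. \<phi> (p e) \<odot>\<^bsub>M\<^esub> m e)" for A
    by (induction A rule: finite_induct)
      (simp_all add: zero add smult M.M.finsum_insert Pi_def M.M.finsum_closed)
  then show ?thesis
    using p unfolding evaluation_def by (simp add: carrier_R)
qed

lemma evaluation_linear:
  assumes p: "p \<in> carrier R" "\<And>e. p e \<noteq> \<zero>\<^bsub>K\<^esub> \<Longrightarrow> e \<in> (\<lambda>a. {#a#}) ` {0..n}"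
    and m: "m \<in> UNIV \<rightarrow> carrier M"
  shows "evaluation m p = (\<Oplus>\<^bsub>M\<^esub>a\<in>{0..n}. \<phi> (p {#a#}) \<odot>\<^bsub>M\<^esub> m {#a#})"
proof -
  have "evaluation m p = (\<Oplus>\<^bsub>M\<^esub>e\<in>(\<lambda>a. {#a#}) ` {0..n}. \<phi> (p e) \<odot>\<^bsub>M\<^esub> m e)"
    using p m by (intro evaluation_superset) auto
  also have "\<dots> = (\<Oplus>\<^bsub>M\<^esub>a\<in>{0..n}. \<phi> (p {#a#}) \<odot>\<^bsub>M\<^esub> m {#a#})"
    using m coeff_closed[OF p(1)] by (intro M.M.finsum_reindex) (auto simp: inj_on_def Pi_iff)
  finally show ?thesis .
qed

end

section \<open>The ideal of annihilating polynomials and the rescaling of operators\<close>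

context frame_extension
begin

text \<open>The contribution of the monomial \<open>e\<close> to the action at \<open>w\<close>. As
  a family in \<open>e\<close> it is what \<open>evaluation\<close> is applied to, so that the
  action of a polynomial becomes an evaluation.\<close>

definition monomial_value where
  "monomial_value f \<omega> w e = (\<omega> 0 ^^ count e 0)
     (multilinear_extension K n V L f (\<lambda>a\<in>{1..n}. (\<omega> a ^^ count e a) (w a)))"

abbreviation scalar where "scalar k \<equiv> k \<odot>\<^bsub>L\<^esub> \<one>\<^bsub>L\<^esub>"

lemma scalar_hom: "scalar \<in> ring_hom K L"
proof (rule ring_hom_memI)
  fix x y assume "x \<in> carrier K" "y \<in> carrier K"
  then show "scalar (x \<otimes>\<^bsub>K\<^esub> y) = scalar x \<otimes>\<^bsub>L\<^esub> scalar y"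
    by (simp add: alg.smult_assoc1 alg.smult_assoc2)
qed (simp_all add: alg.smult_l_distr)

sublocale ev: polynomial_evaluation K n L "base_change K L (V 0)" scalar
  using BV_module[of 0] scalar_hom alg.R_cring
  by (simp add: polynomial_evaluation_def polynomials_def polynomial_evaluation_axioms_def)

lemma poly_action_eq: "poly_action K n V L f p \<omega> w = ev.evaluation (monomial_value f \<omega> w) p"
  unfolding poly_action_def ev.evaluation_def monomial_value_def by simp

lemma funpow_closed:
  assumes "\<omega> \<in> operators K n V L" "a \<le> n" "x \<in> carrier (BV a)"
  shows "(\<omega> a ^^ j) x \<in> carrier (BV a)"
proof -
  have "\<omega> a \<in> linear_maps L (BV a) (BV a)"
    using assms(1,2) by (auto simp: operators_def)
  then show ?thesis using assms(3) linear_mapsD(1) by (induction j) fastforce+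
qed

lemma funpow_args:
  assumes "\<omega> \<in> operators K n V L" "w \<in> args n BV"
  shows "(\<lambda>a\<in>{1..n}. (\<omega> a ^^ j a) (w a)) \<in> args n BV"
  using assms(2) by (auto simp: args_def intro!: funpow_closed[OF assms(1)])

context
  fixes f \<omega>
  assumes f: "f \<in> multilinear_maps K n V" and \<omega>: "\<omega> \<in> operators K n V L"
begin

lemma monomial_value_closed:
  assumes "w \<in> args n BV"
  shows "monomial_value f \<omega> w \<in> UNIV \<rightarrow> carrier (BV 0)"
  unfolding monomial_value_def
  using multilinear_mapsD(1)[OF multilinear_extension_in[OF f] funpow_args[OF \<omega> assms]]
  by (auto intro!: funpow_closed[OF \<omega>])

text \<open>Each operator acts on its own factor, so only powers of the same operator are composed.
  The share of \<open>c\<close> is applied first on the inputs and last on the output.\<close>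

lemma monomial_value_add:
  "monomial_value f \<omega> w (c + d) =
    (\<omega> 0 ^^ count c 0) (monomial_value f \<omega> (\<lambda>a\<in>{1..n}. (\<omega> a ^^ count c a) (w a)) d)"
proof -
  have "(\<omega> a ^^ count (c + d) a) (w a) = (\<omega> a ^^ count d a) ((\<omega> a ^^ count c a) (w a))" for a
    by (simp add: add.commute[of "count c a"] funpow_add)
  then show ?thesis
    unfolding monomial_value_def by (simp add: funpow_add cong: restrict_cong)
qed

text \<open>For each monomial \<open>c\<close>, evaluating \<open>p\<close> on the family shifted by
  \<open>c\<close> gives a power of \<open>\<omega> 0\<close> applied to the action of
  \<open>p\<close> at modified arguments. That action is zero since \<open>p\<close> annihilates at
  all arguments, and \<open>evaluation_mult\<close> combines these values into the action of the
  product.\<close>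

lemma annihilates_mult:
  assumes p: "p \<in> carrier ev.R" and q: "q \<in> carrier ev.R" and ann: "annihilates K n V L f p \<omega>"
  shows "annihilates K n V L f (q \<otimes>\<^bsub>ev.R\<^esub> p) \<omega>"
  unfolding annihilates_def
proof
  fix w assume w: "w \<in> args n BV"
  have T: "\<omega> 0 \<in> linear_maps L (BV 0) (BV 0)"
    using \<omega> by (auto simp: operators_def)
  have "ev.evaluation (\<lambda>d. monomial_value f \<omega> w (c + d)) p = \<zero>\<^bsub>BV 0\<^esub>" for c
  proof -
    let ?w = "\<lambda>a\<in>{1..n}. (\<omega> a ^^ count c a) (w a)"
    have w': "?w \<in> args n BV" by (rule funpow_args[OF \<omega> w])
    have "ev.evaluation (\<lambda>d. monomial_value f \<omega> w (c + d)) p =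
        (\<omega> 0 ^^ count c 0) (ev.evaluation (monomial_value f \<omega> ?w) p)"
      unfolding monomial_value_add
      by (rule ev.evaluation_commutes_funpow[OF T p monomial_value_closed[OF w']])
    also have "ev.evaluation (monomial_value f \<omega> ?w) p = \<zero>\<^bsub>BV 0\<^esub>"
      using ann w' unfolding annihilates_def poly_action_eq by blast
    \<comment> \<open>Writing zero as a value of the zero polynomial lets
      \<open>evaluation_commutes_funpow\<close> also show that the power of
      \<open>\<omega> 0\<close> fixes zero.\<close>
    also have "\<dots> = ev.evaluation (\<lambda>_. \<zero>\<^bsub>BV 0\<^esub>) \<zero>\<^bsub>ev.R\<^esub>"
      by (simp add: ev.evaluation_zero)
    also have "(\<omega> 0 ^^ count c 0) \<dots> = ev.evaluation (\<lambda>e. (\<omega> 0 ^^ count c 0) \<zero>\<^bsub>BV 0\<^esub>) \<zero>\<^bsub>ev.R\<^esub>"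
      by (rule ev.evaluation_commutes_funpow[OF T, symmetric]) auto
    also have "\<dots> = \<zero>\<^bsub>BV 0\<^esub>" by (rule ev.evaluation_zero)
    finally show ?thesis .
  qed
  then show "poly_action K n V L f (q \<otimes>\<^bsub>ev.R\<^esub> p) \<omega> w = \<zero>\<^bsub>BV 0\<^esub>"
    unfolding poly_action_eq ev.evaluation_mult[OF p q monomial_value_closed[OF w]]
    unfolding ev.evaluation_def[of _ q]
    using ev.coeff_closed[OF q] by (intro ev.M.M.add.finprod_one_eqI) simp
qed

lemma annihilates_add:
  assumes "p \<in> carrier ev.R" "annihilates K n V L f p \<omega>"
    and "q \<in> carrier ev.R" "annihilates K n V L f q \<omega>"
  shows "annihilates K n V L f (p \<oplus>\<^bsub>ev.R\<^esub> q) \<omega>"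
  using assms unfolding annihilates_def poly_action_eq
  by (simp add: ev.evaluation_add monomial_value_closed)

text \<open>Reduces annihilation by a generated ideal to annihilation by its generators, through
  minimality of the generated ideal.\<close>

lemma ideal_annihilating: "ideal {p \<in> carrier ev.R. annihilates K n V L f p \<omega>} ev.R"
proof (rule idealI)
  show "ring ev.R" by (rule ev.R.ring_axioms)
  let ?I = "{p \<in> carrier ev.R. annihilates K n V L f p \<omega>}"
  show "subgroup ?I (add_monoid ev.R)"
  proof (rule ev.R.add.subgroupI)
    have "annihilates K n V L f \<zero>\<^bsub>ev.R\<^esub> \<omega>"
      unfolding annihilates_def poly_action_eq by (simp add: ev.evaluation_zero)
    then show "?I \<noteq> {}" by blast
    fix p assume p: "p \<in> ?I"
    then have "\<ominus>\<^bsub>ev.R\<^esub> p = (\<ominus>\<^bsub>ev.R\<^esub> \<one>\<^bsub>ev.R\<^esub>) \<otimes>\<^bsub>ev.R\<^esub> p"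
      by (simp add: ev.R.l_minus)
    then show "\<ominus>\<^bsub>ev.R\<^esub> p \<in> ?I"
      using p annihilates_mult[of p "\<ominus>\<^bsub>ev.R\<^esub> \<one>\<^bsub>ev.R\<^esub>"] by simp
  qed (use annihilates_add in auto)
  fix p q assume p: "p \<in> ?I" and q: "q \<in> carrier ev.R"
  then show "q \<otimes>\<^bsub>ev.R\<^esub> p \<in> ?I" using annihilates_mult by simp
  then show "p \<otimes>\<^bsub>ev.R\<^esub> q \<in> ?I" using p q by (simp add: ev.R.m_comm)
qed

end

text \<open>
  The coefficients \<open>d\<^sub>a\<close> of \<open>d\<close> satisfy \<open>d\<^sub>a\<^sup>2 = 1\<close>, so that \<open>d\<close> takes at the operators
  \<open>d\<^sub>a \<lambda>\<^sub>a \<omega>\<^sub>a\<close> the value of \<open>\<Sum>\<^sub>a \<lambda>\<^sub>a x\<^sub>a\<close> at \<open>\<omega>\<close>.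
\<close>

definition rescaled_operators where
  "rescaled_operators p \<omega> = (\<lambda>a\<in>{0..n}. \<lambda>x\<in>carrier (BV a).
     scalar (deriv_poly K n {#a#} \<otimes>\<^bsub>K\<^esub> p {#a#}) \<odot>\<^bsub>BV a\<^esub> \<omega> a x)"

lemma rescaled_operators:
  assumes p: "p \<in> carrier ev.R" and \<omega>: "\<omega> \<in> operators K n V L"
  shows "rescaled_operators p \<omega> \<in> operators K n V L"
  unfolding operators_def rescaled_operators_def
proof (rule restrict_PiE_iff[THEN iffD2], rule ballI)
  fix a assume a: "a \<in> {0..n}"
  interpret M: module L "BV a" using BV_module a by simp
  let ?c = "scalar (deriv_poly K n {#a#} \<otimes>\<^bsub>K\<^esub> p {#a#})"
  have c: "?c \<in> carrier L"
    using ev.coeff_closed[OF p] ev.coeff_closed[OF ev.deriv_poly_closed] by simp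
  have "\<omega> a \<in> linear_maps L (BV a) (BV a)"
    using \<omega> a by (auto simp: operators_def)
  note \<omega>a = linear_mapsD[OF this]
  have "?c \<odot>\<^bsub>BV a\<^esub> (r \<odot>\<^bsub>BV a\<^esub> x) = r \<odot>\<^bsub>BV a\<^esub> (?c \<odot>\<^bsub>BV a\<^esub> x)" if "r \<in> carrier L" "x \<in> carrier (BV a)" for r x
    using that c by (metis M.smult_assoc1 alg.m_comm)
  then show "(\<lambda>x\<in>carrier (BV a). ?c \<odot>\<^bsub>BV a\<^esub> \<omega> a x) \<in> linear_maps L (BV a) (BV a)"
    using c by (simp add: linear_maps_def \<omega>a M.smult_r_distr)
qed

lemma monomial_value_var:
  assumes f: "f \<in> multilinear_maps K n V" and w: "w \<in> args n BV" and a: "a \<in> {0..n}"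
  shows "monomial_value f \<omega> w {#a#} =
    (if a = 0 then \<omega> 0 (multilinear_extension K n V L f w)
     else multilinear_extension K n V L f (w(a := \<omega> a (w a))))"
proof -
  have "(\<lambda>b\<in>{1..n}. (\<omega> b ^^ count {#a#} b) (w b)) = (if a = 0 then w else w(a := \<omega> a (w a)))"
  proof
    fix b
    \<comment> \<open>Off \<open>{1..n}\<close> the restricted function is \<open>undefined\<close>,
      and so is \<open>w\<close> as an extensional tuple.\<close>
    have "w b = undefined" if "b \<notin> {1..n}"
      using PiE_arb[OF w[unfolded args_def] that] .
    then show "(\<lambda>b\<in>{1..n}. (\<omega> b ^^ count {#a#} b) (w b)) b = (if a = 0 then w else w(a := \<omega> a (w a))) b"
      using a by (cases "b \<in> {1..n}"; cases "b = a") simp_all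
  qed
  then show ?thesis unfolding monomial_value_def by simp
qed

text \<open>Linearity in argument \<open>a\<close> pulls the rescaling factor out of the multilinear
  map; for \<open>a = 0\<close> it stands outside already. Together with the coefficient of
  \<open>deriv_poly\<close> the sign is squared away and the coefficient of \<open>p\<close>
  remains.\<close>

lemma poly_action_deriv_poly_rescaled:
  assumes f: "f \<in> multilinear_maps K n V" and \<omega>: "\<omega> \<in> operators K n V L"
    and p: "p \<in> linear_forms K n" and w: "w \<in> args n BV"
  shows "poly_action K n V L f (deriv_poly K n) (rescaled_operators p \<omega>) w = poly_action K n V L f p \<omega> w"
proof -
  let ?d = "deriv_poly K n" and ?\<omega> = "rescaled_operators p \<omega>" and ?g = "multilinear_extension K n V L f"
  note pR = ev.linear_formsE(1)[OF p] and dR = ev.deriv_poly_closed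
  note pc [simp] = ev.coeff_closed[OF pR] and dc [simp] = ev.coeff_closed[OF dR]
  have \<omega>': "?\<omega> \<in> operators K n V L" by (rule rescaled_operators[OF pR \<omega>])
  note g = multilinear_extension_in[OF f]
  have gw: "?g w \<in> carrier (BV 0)" using multilinear_mapsD(1)[OF g w] .
  have m: "monomial_value f \<omega> w e \<in> carrier (BV 0)" for e
    using monomial_value_closed[OF f \<omega> w] by auto
  have step: "monomial_value f ?\<omega> w {#a#} =
      scalar (?d {#a#} \<otimes>\<^bsub>K\<^esub> p {#a#}) \<odot>\<^bsub>BV 0\<^esub> monomial_value f \<omega> w {#a#}" if a: "a \<in> {0..n}" for a
  proof (cases "a = 0")
    case True
    then show ?thesis using gw by (simp add: monomial_value_var[OF f w] rescaled_operators_def)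
  next
    case False
    then have a1: "a \<in> {1..n}" using a by simp
    have wa: "w a \<in> carrier (BV a)" using args_closed[OF w a1] .
    then have \<omega>wa: "\<omega> a (w a) \<in> carrier (BV a)"
      using funpow_closed[OF \<omega>, of a "w a" 1] a by simp
    have M: "module L (BV a)" using BV_module a by simp
    let ?c = "scalar (?d {#a#} \<otimes>\<^bsub>K\<^esub> p {#a#})"
    have c: "?c \<in> carrier L" by simp
    have "(\<lambda>x\<in>carrier (BV a). ?g (w(a := x))) (?c \<odot>\<^bsub>BV a\<^esub> \<omega> a (w a)) =
        ?c \<odot>\<^bsub>BV 0\<^esub> (\<lambda>x\<in>carrier (BV a). ?g (w(a := x))) (\<omega> a (w a))"
      by (rule linear_mapsD(3)[OF multilinear_mapsD(2)[OF g w a1] c \<omega>wa])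
    then have "?g (w(a := ?c \<odot>\<^bsub>BV a\<^esub> \<omega> a (w a))) = ?c \<odot>\<^bsub>BV 0\<^esub> ?g (w(a := \<omega> a (w a)))"
      using \<omega>wa module.smult_closed[OF M c \<omega>wa] by simp
    then show ?thesis
      using False a wa by (simp add: monomial_value_var[OF f w] rescaled_operators_def)
  qed
  \<comment> \<open>The coefficient is \<open>1\<close> for \<open>a = 0\<close> and
    \<open>-1\<close> for the other indices.\<close>
  have square: "?d {#a#} \<otimes>\<^bsub>K\<^esub> (?d {#a#} \<otimes>\<^bsub>K\<^esub> p {#a#}) = p {#a#}" if "a \<in> {0..n}" for a
    using that by (auto simp: ev.deriv_poly_coeff alg.R.l_minus alg.R.minus_minus)
  have "poly_action K n V L f ?d ?\<omega> w =
      (\<Oplus>\<^bsub>BV 0\<^esub>a\<in>{0..n}. scalar (?d {#a#}) \<odot>\<^bsub>BV 0\<^esub> monomial_value f ?\<omega> w {#a#})"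
    unfolding poly_action_eq
    by (rule ev.evaluation_linear[OF dR _ monomial_value_closed[OF f \<omega>' w]])
      (auto simp: ev.deriv_poly_coeff split: if_splits)
  also have "\<dots> = (\<Oplus>\<^bsub>BV 0\<^esub>a\<in>{0..n}. scalar (p {#a#}) \<odot>\<^bsub>BV 0\<^esub> monomial_value f \<omega> w {#a#})"
  proof (intro ev.M.M.finsum_cong' refl)
    fix a assume a: "a \<in> {0..n}"
    have "scalar (?d {#a#}) \<odot>\<^bsub>BV 0\<^esub> monomial_value f ?\<omega> w {#a#} =
        (scalar (?d {#a#}) \<otimes>\<^bsub>L\<^esub> scalar (?d {#a#} \<otimes>\<^bsub>K\<^esub> p {#a#})) \<odot>\<^bsub>BV 0\<^esub> monomial_value f \<omega> w {#a#}"
      unfolding step[OF a] using m by (intro ev.M.smult_assoc1[symmetric]) simp_all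
    also have "scalar (?d {#a#}) \<otimes>\<^bsub>L\<^esub> scalar (?d {#a#} \<otimes>\<^bsub>K\<^esub> p {#a#}) =
        scalar (?d {#a#} \<otimes>\<^bsub>K\<^esub> (?d {#a#} \<otimes>\<^bsub>K\<^esub> p {#a#}))"
      by (rule ring_hom_mult[OF scalar_hom, symmetric]) simp_all
    finally show "scalar (?d {#a#}) \<odot>\<^bsub>BV 0\<^esub> monomial_value f ?\<omega> w {#a#} =
        scalar (p {#a#}) \<odot>\<^bsub>BV 0\<^esub> monomial_value f \<omega> w {#a#}"
      using square[OF a] by simp
  qed (use m in auto)
  also have "\<dots> = poly_action K n V L f p \<omega> w"
    unfolding poly_action_eq
    by (rule ev.evaluation_linear[OF pR ev.linear_formsE(2)[OF p] monomial_value_closed[OF f \<omega> w], symmetric])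
  finally show ?thesis .
qed

end

text \<open>Every generator of the ideal has its own rescaling of \<open>\<omega>\<close>; the
  resulting statements about \<open>t\<close> are put together by
  \<open>ideal_annihilating\<close>.\<close>

lemma null_tensors_linear_homogeneous_ideal:
  fixes K :: "'k ring" and V :: "nat \<Rightarrow> ('k, 'v) module" and T :: "('k, 't) module"
  assumes "tensor_space K n V T br" and S: "S \<subseteq> carrier T" and P: "linear_homogeneous_ideal K n P"
  shows "null_tensors K n V T br {deriv_poly K n}
      (zero_locus K n V br S {deriv_poly K n} :: ('k, 'l, 'v) operator_family) \<subseteq>
    null_tensors K n V T br P (zero_locus K n V br S P :: ('k, 'l, 'v) operator_family)"
proof
  interpret tensor_space K n V T br by fact
  interpret polynomials K n using base_cring by (simp add: polynomials_def)
  let ?d = "deriv_poly K n"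
  fix t assume t: "t \<in> null_tensors K n V T br {?d}
      (zero_locus K n V br S {?d} :: ('k, 'l, 'v) operator_family)"
  have br: "br s \<in> multilinear_maps K n V" if "s \<in> carrier T" for s
    using linear_mapsD(1)[OF br_linear that] by (simp add: multilinear_module_def)
  have tT: "t \<in> carrier T" using t by (simp add: null_tensors_def)
  obtain G where G: "G \<subseteq> linear_forms K n" and PG: "P = Idl\<^bsub>R\<^esub> G"
    using P unfolding linear_homogeneous_ideal_def by blast
  have GR: "G \<subseteq> carrier R" using G linear_formsE(1) by blast
  have GP: "G \<subseteq> P" unfolding PG by (rule R.genideal_self[OF GR])
  have "annihilates K n V L (br t) p \<omega>"
    if L: "algebra K L" and \<omega>: "\<omega> \<in> zero_locus K n V br S P L" and p: "p \<in> P"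
    for L :: "('k, 'l) module" and \<omega> p
  proof -
    interpret frame_extension K L n V
      using L frame_module by (simp add: frame_extension_def frame_extension_axioms_def)
    have \<omega>': "\<omega> \<in> operators K n V L" using \<omega> by (simp add: zero_locus_def)
    have "annihilates K n V L (br t) q \<omega>" if q: "q \<in> G" for q
    proof -
      have ql: "q \<in> linear_forms K n" using q G by blast
      \<comment> \<open>Used in both directions: for tensors in \<open>S\<close> it places the
        rescaled operators in the zero locus of \<open>?d\<close>, and for \<open>t\<close> it
        returns from \<open>?d\<close> to the generator \<open>q\<close>.\<close>
      have eq: "annihilates K n V L (br s) ?d (rescaled_operators q \<omega>) \<longleftrightarrow> annihilates K n V L (br s) q \<omega>"
        if "s \<in> carrier T" for s
        using poly_action_deriv_poly_rescaled[OF br[OF that] \<omega>' ql] by (simp add: annihilates_def)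
      have "annihilates K n V L (br s) ?d (rescaled_operators q \<omega>)" if "s \<in> S" for s
        using eq[OF subsetD[OF S that]] \<omega> that subsetD[OF GP q] by (simp add: zero_locus_def)
      then have "rescaled_operators q \<omega> \<in> zero_locus K n V br S {?d} L"
        using rescaled_operators[OF linear_formsE(1)[OF ql] \<omega>'] by (simp add: zero_locus_def)
      then have "annihilates K n V L (br t) ?d (rescaled_operators q \<omega>)"
        using t L by (simp add: null_tensors_def)
      then show ?thesis using eq[OF tT] by simp
    qed
    then have "P \<subseteq> {p \<in> carrier R. annihilates K n V L (br t) p \<omega>}"
      unfolding PG using GR by (intro R.genideal_minimal ideal_annihilating[OF br[OF tT] \<omega>']) auto
    then show ?thesis using p by blast
  qed
  then show "t \<in> null_tensors K n V T br P (zero_locus K n V br S P :: ('k, 'l, 'v) operator_family)"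
    using tT unfolding null_tensors_def by blast
qed

theorem theorem3:
  fixes K :: "'k ring" and n :: nat and V :: "nat \<Rightarrow> ('k, 'v) module"
    and T :: "('k, 't) module" and br :: "'t \<Rightarrow> (nat \<Rightarrow> 'v) \<Rightarrow> 'v"
    and S :: "'t set"
  defines "Z \<equiv> (zero_locus K n V br S ::
      (nat multiset \<Rightarrow> 'k) set \<Rightarrow> ('k, 'l, 'v) operator_family)"
    and "N \<equiv> (null_tensors K n V T br ::
      (nat multiset \<Rightarrow> 'k) set \<Rightarrow> ('k, 'l, 'v) operator_family \<Rightarrow> 't set)"
    and "d \<equiv> deriv_poly K n"
  assumes "tensor_space K n V T br"
    and "\<And>a. a \<le> n \<Longrightarrow> finitely_generated K (V a) \<and> projective_module K (V a)"
    and "S \<subseteq> carrier T"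
  shows "(\<forall>P. linear_homogeneous_ideal K n P \<and> ideal_support K n P = {0..n} \<longrightarrow>
            N {d} (Z {d}) \<subseteq> N P (Z P)) \<and>
         (fully_nondegenerate K n V br S \<longrightarrow>
            (\<forall>P. linear_homogeneous_ideal K n P \<longrightarrow> N {d} (Z {d}) \<subseteq> N P (Z P)))"
  unfolding Z_def N_def d_def
  using null_tensors_linear_homogeneous_ideal[OF assms(4,6)] by blast

end
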